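(* Let $M$ be a $d$-dimensional Riemannian manifold with a retraction $\mathrm{Retr}$, let $f:M\to\mathbb R$ be a $C^2$ function, and let $T(x)=\mathrm{Retr}_x(-\eta\,\mathrm{grad} f(x))$ be the manifold gradient descent map for $f$ with step size $\eta>0$, where $\eta$ is small enough that $T$ is a homeomorphism of $M$ onto itself and $f(T(x))<f(x)$ for every $x$ that is not a fixed point of $T$. Let $F$ be the set of fixed points of $T$. Then there exist $d$ $T$-invariant functions which are continuous and independent on an open dense subset of $M\setminus F$.
   Context: The Riemannian gradient $\mathrm{grad} f(x)\in T_xM$ is defined by $Df(x)[s]=\langle \mathrm{grad} f(x),s\rangle_x$ for all $s\in T_xM$. A retraction is a smooth assignment of maps $\mathrm{Retr}_x:T_xM\to M$ with $\mathrm{Retr}_x(0)=x$ and differential at $0$ equal to the identity. A function $\varphi$ is $T$-invariant if $\varphi(T(x))=\varphi(x)$ for all $x$. Functions $\varphi_1,\dots,\varphi_d$ are independent on an open set $U$ if $(\varphi_1,\dots,\varphi_d):U\to\mathbb R^d$ is a local diffeomorphism. *)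

theory Defs
  imports "HOL-Analysis.Analysis"
begin

section \<open>Differentiability classes on open subsets of normed spaces\<close>

text \<open>
  The set is meant to be open. In finite dimension, continuity of all directional derivatives
  \<open>\<lambda>x. Df(x)[v]\<close> is the same as continuity of the derivative for the operator norm.
\<close>

fun Ck_on :: "nat \<Rightarrow> 'a::real_normed_vector set \<Rightarrow> ('a \<Rightarrow> 'b::real_normed_vector) \<Rightarrow> bool" where
  "Ck_on 0 S f \<longleftrightarrow> continuous_on S f"
| "Ck_on (Suc k) S f \<longleftrightarrow>
     (\<forall>x\<in>S. f differentiable (at x)) \<and> (\<forall>v. Ck_on k S (\<lambda>x. frechet_derivative f (at x) v))"

definition smooth_on :: "'a::real_normed_vector set \<Rightarrow> ('a \<Rightarrow> 'b::real_normed_vector) \<Rightarrow> bool" where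
  "smooth_on S f \<longleftrightarrow> (\<forall>k. Ck_on k S f)"


section \<open>Smooth manifolds\<close>

text \<open>
  A chart consists of its domain and its coordinate map; the values of the coordinate map outside
  the domain carry no meaning. The manifold is the whole type \<open>'m\<close>, Hausdorff and second countable
  by its sort, modelled on the Euclidean space \<open>'e\<close>.
\<close>

type_synonym ('m, 'e) chart = "'m set \<times> ('m \<Rightarrow> 'e)"

abbreviation chart_dom :: "('m, 'e) chart \<Rightarrow> 'm set" where
  "chart_dom \<equiv> fst"

abbreviation chart_map :: "('m, 'e) chart \<Rightarrow> 'm \<Rightarrow> 'e" where
  "chart_map \<equiv> snd"

abbreviation chart_inv :: "('m, 'e) chart \<Rightarrow> 'e \<Rightarrow> 'm" where
  "chart_inv c \<equiv> inv_into (chart_dom c) (chart_map c)"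

abbreviation chart_img :: "('m, 'e) chart \<Rightarrow> 'e set" where
  "chart_img c \<equiv> chart_map c ` chart_dom c"

definition transition :: "('m, 'e) chart \<Rightarrow> ('m, 'e) chart \<Rightarrow> 'e \<Rightarrow> 'e" where
  "transition c c' = chart_map c' \<circ> chart_inv c"

definition is_chart :: "('m::topological_space, 'e::euclidean_space) chart \<Rightarrow> bool" where
  "is_chart c \<longleftrightarrow> open (chart_dom c) \<and> open (chart_img c) \<and>
     homeomorphism (chart_dom c) (chart_img c) (chart_map c) (chart_inv c)"

definition smooth_atlas ::
  "('m::{t2_space, second_countable_topology}, 'e::euclidean_space) chart set \<Rightarrow> bool" where
  "smooth_atlas A \<longleftrightarrow>
     (\<forall>c\<in>A. is_chart c) \<and> \<Union> (chart_dom ` A) = UNIV \<and>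
     (\<forall>c\<in>A. \<forall>c'\<in>A. smooth_on (chart_map c ` (chart_dom c \<inter> chart_dom c')) (transition c c'))"

text \<open>\<open>C\<^sup>k\<close> maps on an open subset \<open>U\<close> of the manifold with values in a normed space, and
  \<open>C\<^sup>k\<close> maps on an open subset \<open>W\<close> of a normed space with values in the manifold.\<close>

definition Ck_from ::
  "nat \<Rightarrow> ('m::{t2_space, second_countable_topology}, 'e::euclidean_space) chart set \<Rightarrow>
   'm set \<Rightarrow> ('m \<Rightarrow> 'b::real_normed_vector) \<Rightarrow> bool" where
  "Ck_from k A U h \<longleftrightarrow>
     (\<forall>c\<in>A. Ck_on k (chart_map c ` (chart_dom c \<inter> U)) (h \<circ> chart_inv c))"

definition Ck_into ::
  "nat \<Rightarrow> ('m::{t2_space, second_countable_topology}, 'e::euclidean_space) chart set \<Rightarrow>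
   'b::real_normed_vector set \<Rightarrow> ('b \<Rightarrow> 'm) \<Rightarrow> bool" where
  "Ck_into k A W h \<longleftrightarrow> continuous_on W h \<and>
     (\<forall>c\<in>A. Ck_on k {y \<in> W. h y \<in> chart_dom c} (chart_map c \<circ> h))"


section \<open>Tangent vectors and differentials\<close>

text \<open>
  A tangent vector at \<open>x\<close> is the family of its coordinate vectors in all charts around \<open>x\<close>, related
  by the derivatives of the transition maps; it is set to zero at all other indices so that equality
  of tangent vectors is equality of functions. The vector space operations are pointwise, and the
  zero vector is \<open>\<lambda>c. 0\<close>.
\<close>

type_synonym ('m, 'e) tvec = "('m, 'e) chart \<Rightarrow> 'e"

definition tangent_space ::
  "('m::{t2_space, second_countable_topology}, 'e::euclidean_space) chart set \<Rightarrow>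
   'm \<Rightarrow> ('m, 'e) tvec set" where
  "tangent_space A x = {v.
     (\<forall>c. c \<notin> A \<or> x \<notin> chart_dom c \<longrightarrow> v c = 0) \<and>
     (\<forall>c\<in>A. \<forall>c'\<in>A. x \<in> chart_dom c \<inter> chart_dom c' \<longrightarrow>
        v c' = frechet_derivative (transition c c') (at (chart_map c x)) (v c))}"

text \<open>The tangent vector at \<open>x\<close> whose coordinate vector in the chart \<open>c\<close> (around \<open>x\<close>) is \<open>w\<close>.\<close>

definition tvec_of ::
  "('m::{t2_space, second_countable_topology}, 'e::euclidean_space) chart set \<Rightarrow>
   'm \<Rightarrow> ('m, 'e) chart \<Rightarrow> 'e \<Rightarrow> ('m, 'e) tvec" where
  "tvec_of A x c w = (\<lambda>c'. if c' \<in> A \<and> x \<in> chart_dom c'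
     then frechet_derivative (transition c c') (at (chart_map c x)) w else 0)"

text \<open>\<open>Df(x)[v]\<close> is computed in an arbitrary chart around \<open>x\<close>; by the chain rule it does not depend
  on the chart.\<close>

definition differential ::
  "('m::{t2_space, second_countable_topology}, 'e::euclidean_space) chart set \<Rightarrow>
   ('m \<Rightarrow> real) \<Rightarrow> 'm \<Rightarrow> ('m, 'e) tvec \<Rightarrow> real" where
  "differential A f x v = (let c = (SOME c. c \<in> A \<and> x \<in> chart_dom c)
     in frechet_derivative (f \<circ> chart_inv c) (at (chart_map c x)) (v c))"


section \<open>Riemannian metrics, gradients and retractions\<close>

definition riemannian_metric ::
  "('m::{t2_space, second_countable_topology}, 'e::euclidean_space) chart set \<Rightarrow>
   ('m \<Rightarrow> ('m, 'e) tvec \<Rightarrow> ('m, 'e) tvec \<Rightarrow> real) \<Rightarrow> bool" where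
  "riemannian_metric A g \<longleftrightarrow>
     (\<forall>x. \<forall>u\<in>tangent_space A x. \<forall>v\<in>tangent_space A x. \<forall>w\<in>tangent_space A x. \<forall>a b.
        g x (\<lambda>c. a *\<^sub>R u c + b *\<^sub>R v c) w = a * g x u w + b * g x v w) \<and>
     (\<forall>x. \<forall>u\<in>tangent_space A x. \<forall>v\<in>tangent_space A x. g x u v = g x v u) \<and>
     (\<forall>x. \<forall>u\<in>tangent_space A x. u \<noteq> (\<lambda>c. 0) \<longrightarrow> g x u u > 0) \<and>
     (\<forall>c\<in>A. \<forall>w w'. smooth_on (chart_img c)
        (\<lambda>y. g (chart_inv c y) (tvec_of A (chart_inv c y) c w) (tvec_of A (chart_inv c y) c w')))"

definition riemannian_grad ::
  "('m::{t2_space, second_countable_topology}, 'e::euclidean_space) chart set \<Rightarrow>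
   ('m \<Rightarrow> ('m, 'e) tvec \<Rightarrow> ('m, 'e) tvec \<Rightarrow> real) \<Rightarrow> ('m \<Rightarrow> real) \<Rightarrow> 'm \<Rightarrow> ('m, 'e) tvec" where
  "riemannian_grad A g f x = (THE u. u \<in> tangent_space A x \<and>
     (\<forall>s\<in>tangent_space A x. differential A f x s = g x u s))"

text \<open>
  A retraction is a smooth map on the tangent bundle; \<open>(y, w) \<mapsto> tvec_of A (chart_inv c y) c w\<close>
  are the bundle coordinates induced by a chart \<open>c\<close>. The last conjunct is the condition
  \<open>DRetr\<^sub>x(0) = id\<close>, with \<open>T\<^sub>0(T\<^sub>xM)\<close> identified with \<open>T\<^sub>xM\<close>, read in the chart \<open>c\<close>.
\<close>

definition manifold_retraction ::
  "('m::{t2_space, second_countable_topology}, 'e::euclidean_space) chart set \<Rightarrow>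
   ('m \<Rightarrow> ('m, 'e) tvec \<Rightarrow> 'm) \<Rightarrow> bool" where
  "manifold_retraction A R \<longleftrightarrow>
     (\<forall>c\<in>A. \<forall>k. Ck_into k A (chart_img c \<times> UNIV)
        (\<lambda>(y, w). R (chart_inv c y) (tvec_of A (chart_inv c y) c w))) \<and>
     (\<forall>x. R x (\<lambda>c. 0) = x) \<and>
     (\<forall>c\<in>A. \<forall>x\<in>chart_dom c.
        ((\<lambda>w. chart_map c (R x (tvec_of A x c w))) has_derivative (\<lambda>w. w)) (at 0))"

definition gradient_descent_map ::
  "('m::{t2_space, second_countable_topology}, 'e::euclidean_space) chart set \<Rightarrow>
   ('m \<Rightarrow> ('m, 'e) tvec \<Rightarrow> ('m, 'e) tvec \<Rightarrow> real) \<Rightarrow> ('m \<Rightarrow> ('m, 'e) tvec \<Rightarrow> 'm) \<Rightarrow>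
   ('m \<Rightarrow> real) \<Rightarrow> real \<Rightarrow> 'm \<Rightarrow> 'm" where
  "gradient_descent_map A g R f \<eta> x = R x (\<lambda>c. (- \<eta>) *\<^sub>R riemannian_grad A g f x c)"


section \<open>Invariant and independent functions\<close>

definition invariant_under :: "('m \<Rightarrow> 'm) \<Rightarrow> ('m \<Rightarrow> 'b) \<Rightarrow> bool" where
  "invariant_under T h \<longleftrightarrow> (\<forall>x. h (T x) = h x)"

text \<open>
  Local diffeomorphisms are of class \<open>C\<^sup>1\<close>, inverse branches included. The gradient descent
  map of a \<open>C\<^sup>2\<close> function is in general only \<open>C\<^sup>1\<close>. If a homeomorphism \<open>T\<close> with fixed point set
  \<open>F\<close> admits a \<open>T\<close>-invariant local \<open>C\<^sup>k\<close>-diffeomorphism on an open dense subset of \<open>M - F\<close>, then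
  \<open>T\<close> is \<open>C\<^sup>k\<close> on such a subset, so a higher class cannot be asked for.
\<close>

definition local_diffeo_on ::
  "('m::{t2_space, second_countable_topology}, 'e::euclidean_space) chart set \<Rightarrow>
   'm set \<Rightarrow> ('m \<Rightarrow> 'b::euclidean_space) \<Rightarrow> bool" where
  "local_diffeo_on A U h \<longleftrightarrow>
     (\<forall>x\<in>U. \<exists>V k. open V \<and> x \<in> V \<and> V \<subseteq> U \<and> open (h ` V) \<and> homeomorphism V (h ` V) h k \<and>
        Ck_from 1 A V h \<and> Ck_into 1 A (h ` V) k)"

definition independent_on ::
  "('m::{t2_space, second_countable_topology}, 'e::euclidean_space) chart set \<Rightarrow>
   'm set \<Rightarrow> ('n::finite \<Rightarrow> 'm \<Rightarrow> real) \<Rightarrow> bool" where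
  "independent_on A U \<phi> \<longleftrightarrow> local_diffeo_on A U (\<lambda>x. \<chi> i. \<phi> i x)"

end

theory Submission
  imports Defs
begin

text \<open>
  In charts \<open>T\<close> is of class \<open>C\<^sup>1\<close>, because the gradient solves a linear system with \<open>C\<^sup>1\<close>
  coefficients. An injective \<open>C\<^sup>1\<close> map between open sets of equal dimension cannot have a singular
  derivative everywhere: by Sard's theorem its image would be negligible, by invariance of domain
  it is open. Together with the inverse function theorem, pulling back a local diffeomorphism along
  \<open>T\<close> or along \<open>T\<^sup>-\<^sup>1\<close> gives again a local diffeomorphism on some nonempty open subset of every
  nonempty open set.

  As \<open>f\<close> strictly decreases, every point outside \<open>F\<close> has a neighbourhood that never returns to
  itself. Take a maximal family of open sets, each inside a chart, whose points all lie on distinct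
  orbits. The function that sends a point to the chart coordinates of the representative of its orbit
  in this family is invariant. On the union of the orbits it is locally a chart composed
  with an iterate of \<open>T\<close> or \<open>T\<^sup>-\<^sup>1\<close>, hence a local diffeomorphism on an open dense part of it, and
  by maximality this union is dense outside \<open>F\<close>.
\<close>


section \<open>Calculus of continuously differentiable maps\<close>

text \<open>Derivatives at a point are unique, so any family \<open>f'\<close> of derivatives is the
  Frechet one. This lets the closure lemmas supply explicit formulas for \<open>f'\<close>.\<close>

lemma Ck_on_1_iff:
  "Ck_on 1 S f \<longleftrightarrow>
     (\<exists>f'. (\<forall>x\<in>S. (f has_derivative f' x) (at x)) \<and> (\<forall>v. continuous_on S (\<lambda>x. f' x v)))"
proof
  assume "Ck_on 1 S f"
  then show "\<exists>f'. (\<forall>x\<in>S. (f has_derivative f' x) (at x)) \<and> (\<forall>v. continuous_on S (\<lambda>x. f' x v))"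
    by (intro exI[of _ "\<lambda>x. frechet_derivative f (at x)"]) (simp add: frechet_derivative_works)
next
  assume "\<exists>f'. (\<forall>x\<in>S. (f has_derivative f' x) (at x)) \<and> (\<forall>v. continuous_on S (\<lambda>x. f' x v))"
  then obtain f' where f': "\<And>x. x \<in> S \<Longrightarrow> (f has_derivative f' x) (at x)"
    "\<And>v. continuous_on S (\<lambda>x. f' x v)" by blast
  then have "frechet_derivative f (at x) = f' x" if "x \<in> S" for x
    using frechet_derivative_at that by metis
  then have "continuous_on S (\<lambda>x. frechet_derivative f (at x) v)" for v
    using f'(2)[of v] continuous_on_cong[of S S "\<lambda>x. frechet_derivative f (at x) v"] by simp
  then show "Ck_on 1 S f"
    using f'(1) by (auto simp: differentiable_def)
qed

lemma Ck_on_1E: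
  assumes "Ck_on 1 S f"
  obtains f' where "\<And>x. x \<in> S \<Longrightarrow> (f has_derivative f' x) (at x)"
    "\<And>v. continuous_on S (\<lambda>x. f' x v)"
  using assms unfolding Ck_on_1_iff by blast

lemma Ck_on_1I:
  assumes "\<And>x. x \<in> S \<Longrightarrow> (f has_derivative f' x) (at x)" "\<And>v. continuous_on S (\<lambda>x. f' x v)"
  shows "Ck_on 1 S f"
  using assms unfolding Ck_on_1_iff by blast

lemma Ck_on_1_imp_continuous_on:
  assumes "Ck_on 1 S f"
  shows "continuous_on S f"
proof -
  obtain f' where "\<And>x. x \<in> S \<Longrightarrow> (f has_derivative f' x) (at x)"
    using Ck_on_1E[OF assms] by metis
  then show ?thesis
    by (meson continuous_at_imp_continuous_on has_derivative_continuous)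
qed

lemma Ck_on_1_subset: "Ck_on 1 S f \<Longrightarrow> S' \<subseteq> S \<Longrightarrow> Ck_on 1 S' f"
  unfolding Ck_on_1_iff by (meson continuous_on_subset subsetD)

text \<open>A derivative depends on a whole neighbourhood, so agreement is required on an open set
  around \<open>S\<close>; the derivative family is then the same for both maps.\<close>

lemma Ck_on_1_cong:
  assumes "Ck_on 1 S f" "open S'" "S \<subseteq> S'" "\<And>x. x \<in> S' \<Longrightarrow> f x = g x"
  shows "Ck_on 1 S g"
proof -
  obtain f' where f': "\<And>x. x \<in> S \<Longrightarrow> (f has_derivative f' x) (at x)"
    "\<And>v. continuous_on S (\<lambda>x. f' x v)" using Ck_on_1E[OF assms(1)] by metis
  show ?thesis
  proof (rule Ck_on_1I[OF _ f'(2)])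
    fix x assume "x \<in> S"
    then show "(g has_derivative f' x) (at x)"
      using has_derivative_transform_within_open[OF f'(1) assms(2), of x g] assms(3,4) by blast
  qed
qed

text \<open>The chain rule. The middle space is Euclidean so that continuity of \<open>g'\<close> in
  each fixed direction can be turned into joint continuity.\<close>

lemma Ck_on_1_compose:
  fixes f :: "'a::real_normed_vector \<Rightarrow> 'b::euclidean_space" and g :: "'b \<Rightarrow> 'c::real_normed_vector"
  assumes f: "Ck_on 1 S f" and g: "Ck_on 1 W g" and sub: "f ` S \<subseteq> W"
  shows "Ck_on 1 S (g \<circ> f)"
proof -
  obtain f' where f': "\<And>x. x \<in> S \<Longrightarrow> (f has_derivative f' x) (at x)"
    "\<And>v. continuous_on S (\<lambda>x. f' x v)" using Ck_on_1E[OF f] by metis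
  obtain g' where g': "\<And>x. x \<in> W \<Longrightarrow> (g has_derivative g' x) (at x)"
    "\<And>v. continuous_on W (\<lambda>x. g' x v)" using Ck_on_1E[OF g] by metis
  show ?thesis
  proof (rule Ck_on_1I)
    show "((g \<circ> f) has_derivative g' (f x) \<circ> f' x) (at x)" if "x \<in> S" for x
      using that sub by (intro diff_chain_at f' g') auto
    fix v
    \<comment> \<open>The direction \<open>f' x v\<close> fed to \<open>g'\<close> moves with
      \<open>x\<close>, whereas continuity of \<open>g'\<close> is known only for constant
      directions. Expanding in the basis leaves constant directions with continuous
      coefficients.\<close>
    have "(g' (f x) \<circ> f' x) v = (\<Sum>b\<in>Basis. (f' x v \<bullet> b) *\<^sub>R g' (f x) b)" if "x \<in> S" for x
    proof -
      have lin: "linear (g' (f x))"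
        using g'(1)[of "f x"] sub that has_derivative_linear by blast
      have "g' (f x) (f' x v) = g' (f x) (\<Sum>b\<in>Basis. (f' x v \<bullet> b) *\<^sub>R b)"
        by (simp add: euclidean_representation)
      also have "\<dots> = (\<Sum>b\<in>Basis. (f' x v \<bullet> b) *\<^sub>R g' (f x) b)"
        by (simp add: linear_sum[OF lin] linear_scale[OF lin])
      finally show ?thesis by simp
    qed
    moreover have "continuous_on S (\<lambda>x. \<Sum>b\<in>Basis. (f' x v \<bullet> b) *\<^sub>R g' (f x) b)"
      using Ck_on_1_imp_continuous_on[OF f] sub
      by (intro continuous_intros f' continuous_on_compose2[OF g'(2)])
    ultimately show "continuous_on S (\<lambda>x. (g' (f x) \<circ> f' x) v)"
      by (metis (no_types, lifting) continuous_on_cong)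
  qed
qed

lemma Ck_on_1_const: "Ck_on 1 S (\<lambda>x. c)"
  by (rule Ck_on_1I[where f' = "\<lambda>x v. 0"]) auto

lemma Ck_on_1_ident: "Ck_on 1 S (\<lambda>x. x)"
  by (rule Ck_on_1I[where f' = "\<lambda>x v. v"]) auto

lemma Ck_on_1_Pair:
  assumes "Ck_on 1 S f" "Ck_on 1 S g"
  shows "Ck_on 1 S (\<lambda>x. (f x, g x))"
proof -
  obtain f' where f': "\<And>x. x \<in> S \<Longrightarrow> (f has_derivative f' x) (at x)"
    "\<And>v. continuous_on S (\<lambda>x. f' x v)" using Ck_on_1E[OF assms(1)] by metis
  obtain g' where g': "\<And>x. x \<in> S \<Longrightarrow> (g has_derivative g' x) (at x)"
    "\<And>v. continuous_on S (\<lambda>x. g' x v)" using Ck_on_1E[OF assms(2)] by metis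
  show ?thesis
    by (rule Ck_on_1I[where f' = "\<lambda>x v. (f' x v, g' x v)"])
      (auto intro!: has_derivative_Pair f' g' continuous_intros)
qed

lemma Ck_on_1_scaleR_const:
  assumes "Ck_on 1 S f"
  shows "Ck_on 1 S (\<lambda>x. c *\<^sub>R f x)"
proof -
  obtain f' where f': "\<And>x. x \<in> S \<Longrightarrow> (f has_derivative f' x) (at x)"
    "\<And>v. continuous_on S (\<lambda>x. f' x v)" using Ck_on_1E[OF assms(1)] by metis
  show ?thesis
    by (rule Ck_on_1I[where f' = "\<lambda>x v. c *\<^sub>R f' x v"])
      (auto intro!: has_derivative_scaleR_right f' continuous_intros)
qed

lemma Ck_on_1_vec:
  assumes "\<And>i. Ck_on 1 S (f i)"
  shows "Ck_on 1 S (\<lambda>x. (\<chi> i. f i x) :: real ^ 'n)"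
proof -
  have "\<forall>i. \<exists>f'. (\<forall>x\<in>S. (f i has_derivative f' x) (at x)) \<and> (\<forall>v. continuous_on S (\<lambda>x. f' x v))"
    using assms unfolding Ck_on_1_iff by blast
  then obtain f' where f': "\<And>i x. x \<in> S \<Longrightarrow> (f i has_derivative f' i x) (at x)"
    "\<And>i v. continuous_on S (\<lambda>x. f' i x v)" by metis
  show ?thesis
  proof (rule Ck_on_1I)
    show "((\<lambda>x. (\<chi> i. f i x)) has_derivative (\<lambda>v. \<chi> i. f' i x v)) (at x)" if "x \<in> S" for x
      using f'(1)[OF that]
      by (subst has_derivative_componentwise_within) (auto simp: Basis_vec_def inner_axis)
    show "continuous_on S (\<lambda>x. \<chi> i. f' i x v)" for v
      by (intro continuous_intros f')
  qed
qed

lemma Ck_on_1_add: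
  assumes "Ck_on 1 S f" "Ck_on 1 S g"
  shows "Ck_on 1 S (\<lambda>x. f x + g x)"
proof -
  obtain f' where f': "\<And>x. x \<in> S \<Longrightarrow> (f has_derivative f' x) (at x)"
    "\<And>v. continuous_on S (\<lambda>x. f' x v)" using Ck_on_1E[OF assms(1)] by metis
  obtain g' where g': "\<And>x. x \<in> S \<Longrightarrow> (g has_derivative g' x) (at x)"
    "\<And>v. continuous_on S (\<lambda>x. g' x v)" using Ck_on_1E[OF assms(2)] by metis
  show ?thesis
    by (rule Ck_on_1I[where f' = "\<lambda>x v. f' x v + g' x v"])
      (auto intro!: has_derivative_add f' g' continuous_intros)
qed

lemma Ck_on_1_sum:
  assumes "\<And>i. i \<in> I \<Longrightarrow> Ck_on 1 S (f i)"
  shows "Ck_on 1 S (\<lambda>x. \<Sum>i\<in>I. f i x)"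
  using assms
  by (induction I rule: infinite_finite_induct)
    (simp_all only: sum.infinite sum.empty sum.insert Ck_on_1_const Ck_on_1_add insert_iff simp_thms)

lemma Ck_on_1_mult:
  fixes f g :: "'a::real_normed_vector \<Rightarrow> real"
  assumes "Ck_on 1 S f" "Ck_on 1 S g"
  shows "Ck_on 1 S (\<lambda>x. f x * g x)"
proof -
  obtain f' where f': "\<And>x. x \<in> S \<Longrightarrow> (f has_derivative f' x) (at x)"
    "\<And>v. continuous_on S (\<lambda>x. f' x v)" using Ck_on_1E[OF assms(1)] by metis
  obtain g' where g': "\<And>x. x \<in> S \<Longrightarrow> (g has_derivative g' x) (at x)"
    "\<And>v. continuous_on S (\<lambda>x. g' x v)" using Ck_on_1E[OF assms(2)] by metis
  show ?thesis
    by (rule Ck_on_1I[where f' = "\<lambda>x v. f x * g' x v + f' x v * g x"])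
      (auto intro!: has_derivative_mult f' g' continuous_intros Ck_on_1_imp_continuous_on[OF assms(1)]
        Ck_on_1_imp_continuous_on[OF assms(2)])
qed

lemma Ck_on_1_prod:
  fixes f :: "'i \<Rightarrow> 'a::real_normed_vector \<Rightarrow> real"
  assumes "\<And>i. i \<in> I \<Longrightarrow> Ck_on 1 S (f i)"
  shows "Ck_on 1 S (\<lambda>x. \<Prod>i\<in>I. f i x)"
  using assms
  by (induction I rule: infinite_finite_induct)
    (simp_all only: prod.infinite prod.empty prod.insert Ck_on_1_const Ck_on_1_mult insert_iff simp_thms)

lemma Ck_on_1_divide:
  fixes f g :: "'a::real_normed_vector \<Rightarrow> real"
  assumes "Ck_on 1 S f" "Ck_on 1 S g" and nz: "\<And>x. x \<in> S \<Longrightarrow> g x \<noteq> 0"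
  shows "Ck_on 1 S (\<lambda>x. f x / g x)"
proof -
  obtain f' where f': "\<And>x. x \<in> S \<Longrightarrow> (f has_derivative f' x) (at x)"
    "\<And>v. continuous_on S (\<lambda>x. f' x v)" using Ck_on_1E[OF assms(1)] by metis
  obtain g' where g': "\<And>x. x \<in> S \<Longrightarrow> (g has_derivative g' x) (at x)"
    "\<And>v. continuous_on S (\<lambda>x. g' x v)" using Ck_on_1E[OF assms(2)] by metis
  show ?thesis
    by (rule Ck_on_1I[where f' = "\<lambda>x v. (f' x v * g x - f x * g' x v) / (g x * g x)"])
      (use nz in \<open>auto intro!: has_derivative_divide' f' g' continuous_intros
        Ck_on_1_imp_continuous_on[OF assms(1)] Ck_on_1_imp_continuous_on[OF assms(2)]\<close>)
qed

section \<open>Regularity of determinants and of solutions of linear systems\<close>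

lemma Ck_on_1_det:
  fixes M :: "'a::real_normed_vector \<Rightarrow> real ^ 'n ^ 'n"
  assumes "\<And>i j. Ck_on 1 S (\<lambda>x. M x $ i $ j)"
  shows "Ck_on 1 S (\<lambda>x. det (M x))"
  unfolding det_def by (intro Ck_on_1_sum Ck_on_1_mult Ck_on_1_prod Ck_on_1_const assms)

lemma continuous_on_det:
  fixes M :: "'a::topological_space \<Rightarrow> real ^ 'n ^ 'n"
  assumes "\<And>i j. continuous_on S (\<lambda>x. M x $ i $ j)"
  shows "continuous_on S (\<lambda>x. det (M x))"
  unfolding det_def by (intro continuous_intros assms)

text \<open>By Cramer's rule each component of \<open>u\<close> is a quotient of determinants, hence
  a rational expression in the coefficients. It serves for the gradient, whose coordinates solve
  such a system.\<close>

lemma Ck_on_1_linear_system: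
  fixes M :: "'a::real_normed_vector \<Rightarrow> real ^ 'n ^ 'n" and u b :: "'a \<Rightarrow> real ^ 'n"
  assumes "open S" and M: "\<And>i j. Ck_on 1 S (\<lambda>x. M x $ i $ j)" and b: "\<And>i. Ck_on 1 S (\<lambda>x. b x $ i)"
    and nz: "\<And>x. x \<in> S \<Longrightarrow> det (M x) \<noteq> 0" and u: "\<And>x. x \<in> S \<Longrightarrow> M x *v u x = b x"
  shows "Ck_on 1 S u"
proof (rule Ck_on_1_cong[OF _ \<open>open S\<close> subset_refl])
  show "Ck_on 1 S (\<lambda>x. \<chi> k. det (\<chi> i j. if j = k then b x $ i else M x $ i $ j) / det (M x))"
  proof (intro Ck_on_1_vec Ck_on_1_divide Ck_on_1_det nz M)
    show "Ck_on 1 S (\<lambda>x. (\<chi> i j. if j = k then b x $ i else M x $ i $ j) $ i $ j)" for k i j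
      using M[of i j] b[of i] by (cases "j = k") simp_all
  qed
  show "(\<chi> k. det (\<chi> i j. if j = k then b x $ i else M x $ i $ j) / det (M x)) = u x" if "x \<in> S" for x
    by (rule iffD1[OF cramer[OF nz[OF that]] u[OF that], symmetric])
qed

text \<open>The same quotient of determinants, for merely continuous data. It serves for the
  derivative of a local inverse.\<close>

lemma continuous_on_linear_system:
  fixes M :: "'a::topological_space \<Rightarrow> real ^ 'n ^ 'n" and u b :: "'a \<Rightarrow> real ^ 'n"
  assumes M: "\<And>i j. continuous_on S (\<lambda>x. M x $ i $ j)" and b: "\<And>i. continuous_on S (\<lambda>x. b x $ i)"
    and nz: "\<And>x. x \<in> S \<Longrightarrow> det (M x) \<noteq> 0" and u: "\<And>x. x \<in> S \<Longrightarrow> M x *v u x = b x"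
  shows "continuous_on S u"
proof -
  have *: "continuous_on S (\<lambda>x. \<chi> k. det (\<chi> i j. if j = k then b x $ i else M x $ i $ j) / det (M x))"
  proof (intro continuous_on_vec_lambda continuous_on_divide continuous_on_det ballI nz M)
    show "continuous_on S (\<lambda>x. (\<chi> i j. if j = k then b x $ i else M x $ i $ j) $ i $ j)" for k i j
      using M[of i j] b[of i] by (cases "j = k") simp_all
  qed
  have "u x = (\<chi> k. det (\<chi> i j. if j = k then b x $ i else M x $ i $ j) / det (M x))" if "x \<in> S" for x
    by (rule iffD1[OF cramer[OF nz[OF that]] u[OF that]])
  then show ?thesis
    by (rule continuous_on_eq[OF * sym])
qed


section \<open>Diffeomorphisms between open sets\<close>

text \<open>\<open>baby_Sard\<close> asks for a well-ordered index type. This copy of a finite type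
  carries the order transported from an enumeration.\<close>

typedef 'a ordered_copy = "UNIV :: 'a set" ..

lemma bij_Rep_ordered_copy: "bij Rep_ordered_copy"
  by (simp add: bij_def inj_def Rep_ordered_copy_inject
      type_definition.Rep_range[OF type_definition_ordered_copy])

instance ordered_copy :: (finite) finite
proof
  show "finite (UNIV :: 'a ordered_copy set)"
    using bij_betw_finite[OF bij_Rep_ordered_copy[where 'a = 'a]] by simp
qed

instantiation ordered_copy :: (finite) linorder begin
definition "a < b \<longleftrightarrow> to_nat_on UNIV (Rep_ordered_copy a) < to_nat_on UNIV (Rep_ordered_copy b)"
definition "a \<le> b \<longleftrightarrow> to_nat_on UNIV (Rep_ordered_copy a) \<le> to_nat_on UNIV (Rep_ordered_copy b)"

instance
proof intro_classes
  fix x y :: "'a ordered_copy"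
  assume "x \<le> y" "y \<le> x"
  then show "x = y"
    using inj_on_to_nat_on[OF countable_finite[OF finite], of "UNIV :: 'a set"]
    by (simp add: less_eq_ordered_copy_def inj_eq Rep_ordered_copy_inject)
qed (auto simp: less_ordered_copy_def less_eq_ordered_copy_def)
end

instance ordered_copy :: (finite) wellorder
proof -
  have "wf {(x :: 'a ordered_copy, y). x < y}"
    by (auto simp: trancl_def tranclp_less intro!: finite_acyclic_wf acyclicI)
  then show "OFCLASS('a ordered_copy, wellorder_class)"
    by (rule wf_wellorderI) intro_classes
qed

text \<open>If all derivatives were singular, Sard's theorem would make the image negligible;
  invariance of domain makes it open and nonempty, and such a set is never negligible.\<close>

lemma injective_imp_nonsingular_derivative_somewhere:
  fixes F :: "real ^ 'n \<Rightarrow> real ^ 'n"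
  assumes "open \<Omega>" "\<Omega> \<noteq> {}" and inj: "inj_on F \<Omega>"
    and der: "\<And>y. y \<in> \<Omega> \<Longrightarrow> (F has_derivative F' y) (at y)"
  shows "\<exists>y\<in>\<Omega>. inj (F' y)"
proof (rule ccontr)
  assume neg: "\<not> ?thesis"
  \<comment> \<open>\<open>p\<close> and \<open>q\<close> are mutually inverse relabellings of
    coordinates, which move the problem to the index type that \<open>baby_Sard\<close>
    accepts.\<close>
  define p :: "real ^ 'n \<Rightarrow> real ^ 'n ordered_copy" where "p = (\<lambda>x. \<chi> i. x $ Rep_ordered_copy i)"
  define q :: "real ^ 'n ordered_copy \<Rightarrow> real ^ 'n" where "q = (\<lambda>x. \<chi> i. x $ Abs_ordered_copy i)"
  have pq: "p (q x) = x" for x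
    by (simp add: p_def q_def vec_eq_iff Rep_ordered_copy_inverse)
  have qp: "q (p x) = x" for x
    by (simp add: p_def q_def vec_eq_iff Abs_ordered_copy_inverse)
  have lin: "linear p" "linear q"
    by (auto simp: p_def q_def vec_eq_iff intro!: linearI)
  have bl: "bounded_linear p" "bounded_linear q"
    using lin linear_conv_bounded_linear by blast+
  have p_img: "p ` X = q -` X" for X
  proof
    show "q -` X \<subseteq> p ` X"
    proof
      fix x assume "x \<in> q -` X"
      then show "x \<in> p ` X"
        by (intro image_eqI[of x p "q x"]) (simp_all add: pq)
    qed
  qed (auto simp: qp)
  have F_cont: "continuous_on \<Omega> F"
    by (meson der continuous_at_imp_continuous_on has_derivative_continuous)
  define G where "G = p \<circ> F \<circ> q"
  have "open (p ` \<Omega>)"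
    unfolding p_img using bl(2) \<open>open \<Omega>\<close> by (intro open_vimage linear_continuous_on)
  moreover have "continuous_on (p ` \<Omega>) G"
    unfolding G_def
    by (intro continuous_on_compose linear_continuous_on bl continuous_on_subset[OF F_cont])
      (auto simp: qp)
  moreover have "inj_on G (p ` \<Omega>)"
  proof (rule inj_onI)
    fix u v assume uv: "u \<in> p ` \<Omega>" "v \<in> p ` \<Omega>" "G u = G v"
    then have "q (p (F (q u))) = q (p (F (q v)))"
      unfolding G_def by (simp only: o_apply)
    then have "F (q u) = F (q v)" by (simp only: qp)
    moreover have "q u \<in> \<Omega>" "q v \<in> \<Omega>" using uv(1,2) by (simp_all add: p_img)
    ultimately have "q u = q v" using inj by (meson inj_onD)
    then show "u = v" using pq by metis
  qed
  ultimately have "open (G ` p ` \<Omega>)"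
    by (intro invariance_of_domain)
  moreover have "G ` p ` \<Omega> \<noteq> {}" using \<open>\<Omega> \<noteq> {}\<close> by blast
  moreover have "negligible (G ` p ` \<Omega>)"
  proof (rule baby_Sard)
    fix x assume "x \<in> p ` \<Omega>"
    then have q: "q x \<in> \<Omega>" by (auto simp: qp)
    have "(G has_derivative p \<circ> F' (q x) \<circ> q) (at x)"
      unfolding G_def
      by (intro diff_chain_at bounded_linear_imp_has_derivative bl der q)
    then show "(G has_derivative p \<circ> F' (q x) \<circ> q) (at x within p ` \<Omega>)"
      by (rule has_derivative_at_withinI)
    then have "linear (p \<circ> F' (q x) \<circ> q)" by (rule has_derivative_linear)
    \<comment> \<open>Relabelling is bijective, so singularity of \<open>F' (q x)\<close> passes to
      the conjugated derivative, whose rank is therefore below the dimension.\<close>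
    moreover have "\<not> inj (p \<circ> F' (q x) \<circ> q)"
    proof
      assume i: "inj (p \<circ> F' (q x) \<circ> q)"
      have "inj (F' (q x))"
      proof (rule injI)
        fix v w assume "F' (q x) v = F' (q x) w"
        then have "(p \<circ> F' (q x) \<circ> q) (p v) = (p \<circ> F' (q x) \<circ> q) (p w)" by (simp add: qp)
        then have "p v = p w" using i by (meson injD)
        then show "v = w" using qp by metis
      qed
      then show False using neg q by blast
    qed
    ultimately show "rank (matrix (p \<circ> F' (q x) \<circ> q)) < CARD('n ordered_copy)"
      by (simp add: less_rank_noninjective)
  qed simp
  ultimately show False
    using open_not_negligible by blast
qed

text \<open>The inverse is carried along explicitly so that the two sides can be exchanged, as is
  done when pulling back along the inverse of \<open>T\<close>.\<close>

definition diffeo :: "'a::euclidean_space set \<Rightarrow> 'b::euclidean_space set \<Rightarrow> ('a \<Rightarrow> 'b) \<Rightarrow> ('b \<Rightarrow> 'a) \<Rightarrow> bool"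
  where "diffeo P Q F G \<longleftrightarrow>
    open P \<and> open Q \<and> homeomorphism P Q F G \<and> Ck_on 1 P F \<and> Ck_on 1 Q G"

lemma diffeo_sym: "diffeo P Q F G \<Longrightarrow> diffeo Q P G F"
  unfolding diffeo_def using homeomorphism_sym by blast

text \<open>The inverse function theorem gives a homeomorphism with differentiable inverse; what is
  added is that the derivative of the inverse varies continuously.\<close>

lemma inverse_function_diffeo:
  fixes F :: "real ^ 'n \<Rightarrow> real ^ 'n"
  assumes "open \<Omega>" "y0 \<in> \<Omega>" and inj: "inj (F' y0)"
    and der: "\<And>y. y \<in> \<Omega> \<Longrightarrow> (F has_derivative F' y) (at y)"
    and cont: "\<And>v. continuous_on \<Omega> (\<lambda>y. F' y v)"
  obtains P Q G where "P \<subseteq> \<Omega>" "y0 \<in> P" "diffeo P Q F G"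
proof -
  define f' where "f' = (\<lambda>y. Blinfun (F' y))"
  have f': "blinfun_apply (f' y) = F' y" if "y \<in> \<Omega>" for y
    unfolding f'_def using bounded_linear_Blinfun_apply has_derivative_bounded_linear der[OF that] by blast
  have der': "(F has_derivative blinfun_apply (f' y)) (at y)" if "y \<in> \<Omega>" for y
    using der f' that by simp
  \<comment> \<open>In finite dimension, continuity in every fixed direction implies continuity for
    the operator norm.\<close>
  have cont': "continuous_on \<Omega> f'"
    by (rule continuous_on_blinfun_componentwise)
      (use cont f' in \<open>simp cong: continuous_on_cong\<close>)
  have lin0: "linear (F' y0)"
    using der[OF \<open>y0 \<in> \<Omega>\<close>] has_derivative_linear by blast
  obtain h where h: "linear h" "h \<circ> F' y0 = id"
    using linear_injective_left_inverse[OF lin0 inj] by blast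
  have inv0: "Blinfun h o\<^sub>L f' y0 = id_blinfun"
    using h f'[OF \<open>y0 \<in> \<Omega>\<close>]
    by (intro blinfun_eqI) (simp add: bounded_linear_Blinfun_apply linear_conv_bounded_linear pointfree_idE)
  obtain P Q G G' where *: "open P" "P \<subseteq> \<Omega>" "y0 \<in> P" "open Q" "F y0 \<in> Q" "homeomorphism P Q F G"
    "\<And>y. y \<in> Q \<Longrightarrow> (G has_derivative (G' y)) (at y)"
    "\<And>y. y \<in> Q \<Longrightarrow> G' y = inv (blinfun_apply (f' (G y)))"
    "\<And>y. y \<in> Q \<Longrightarrow> bij (blinfun_apply (f' (G y)))"
    using inverse_function_theorem[OF \<open>open \<Omega>\<close> der' cont' \<open>y0 \<in> \<Omega>\<close> inv0] by metis
  have G: "G y \<in> \<Omega>" if "y \<in> Q" for y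
    using *(2,6) that by (auto simp: homeomorphism_def)
  have G': "G' y = inv (F' (G y))" "bij (F' (G y))" if "y \<in> Q" for y
    using *(8,9)[OF that] f'[OF G[OF that]] by simp_all
  have "Ck_on 1 Q G"
  proof (rule Ck_on_1I[OF *(7)])
    fix v
    show "continuous_on Q (\<lambda>y. G' y v)"
    \<comment> \<open>\<open>G' y v\<close> is the solution of the system with matrix
      \<open>F' (G y)\<close> and constant right-hand side \<open>v\<close>, so it depends
      continuously on \<open>y\<close>.\<close>
    proof (rule continuous_on_linear_system[where M = "\<lambda>y. matrix (F' (G y))" and b = "\<lambda>y. v"])
      show "continuous_on Q (\<lambda>y. matrix (F' (G y)) $ i $ j)" for i j
        unfolding matrix_def using *(6) G
        by (auto intro!: continuous_intros continuous_on_compose2[OF cont] simp: homeomorphism_def)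
      fix y assume y: "y \<in> Q"
      have lin: "linear (F' (G y))"
        using der[OF G[OF y]] has_derivative_linear by blast
      then show "det (matrix (F' (G y))) \<noteq> 0"
        using G'(2)[OF y] det_nz_iff_inj bij_is_inj by blast
      show "matrix (F' (G y)) *v G' y v = v"
        using lin G'[OF y] by (simp add: matrix_works bij_is_surj surj_f_inv_f)
    qed auto
  qed
  moreover have "Ck_on 1 P F"
    using Ck_on_1_subset[OF Ck_on_1I[OF der cont]] *(2) by blast
  ultimately have "diffeo P Q F G"
    unfolding diffeo_def using *(1,4,6) by blast
  with *(2,3) show ?thesis by (rule that)
qed

text \<open>An injective \<open>C1\<close> map may have critical points, as the cube has at 0, but
  they cannot fill an open set. At a regular point the inverse function theorem applies.\<close>

lemma injective_Ck_on_1_imp_diffeo_somewhere: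
  fixes F :: "real ^ 'n \<Rightarrow> real ^ 'n"
  assumes "open \<Omega>" "\<Omega> \<noteq> {}" "inj_on F \<Omega>" "Ck_on 1 \<Omega> F"
  obtains P Q G where "P \<subseteq> \<Omega>" "P \<noteq> {}" "diffeo P Q F G"
proof -
  obtain F' where F': "\<And>x. x \<in> \<Omega> \<Longrightarrow> (F has_derivative F' x) (at x)"
    "\<And>v. continuous_on \<Omega> (\<lambda>x. F' x v)" using Ck_on_1E[OF assms(4)] by metis
  obtain y0 where y0: "y0 \<in> \<Omega>" "inj (F' y0)"
    using injective_imp_nonsingular_derivative_somewhere[OF assms(1,2,3) F'(1)] by blast
  obtain P Q G where "P \<subseteq> \<Omega>" "y0 \<in> P" "diffeo P Q F G"
    by (rule inverse_function_diffeo[OF assms(1) y0 F'])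
  then show ?thesis by (intro that[of P Q G]) auto
qed


section \<open>Charts and local diffeomorphisms\<close>

locale atlas =
  fixes A :: "('m::{t2_space, second_countable_topology}, real ^ 'n) chart set"
  assumes smooth_atlas: "smooth_atlas A"
begin

section \<open>Elementary properties of charts\<close>

lemma
  assumes "c \<in> A"
  shows open_chart_dom: "open (chart_dom c)"
    and open_chart_img: "open (chart_img c)"
    and chart_homeomorphism: "homeomorphism (chart_dom c) (chart_img c) (chart_map c) (chart_inv c)"
  using smooth_atlas assms by (auto simp: smooth_atlas_def is_chart_def)

lemma chart_around: obtains c where "c \<in> A" "x \<in> chart_dom c"
  using smooth_atlas unfolding smooth_atlas_def by blast

lemma chart_inv_map: "c \<in> A \<Longrightarrow> x \<in> chart_dom c \<Longrightarrow> chart_inv c (chart_map c x) = x"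
  by (rule homeomorphism_apply1[OF chart_homeomorphism])

lemma chart_map_inv: "y \<in> chart_img c \<Longrightarrow> chart_map c (chart_inv c y) = y"
  by (rule f_inv_into_f)

lemma chart_inv_in_dom: "y \<in> chart_img c \<Longrightarrow> chart_inv c y \<in> chart_dom c"
  by (rule inv_into_into)

lemma chart_inv_in:
  assumes "c \<in> A" "y \<in> chart_map c ` (chart_dom c \<inter> V)"
  shows "chart_inv c y \<in> V"
proof -
  obtain x where "x \<in> chart_dom c" "x \<in> V" "y = chart_map c x"
    using assms(2) by blast
  then show ?thesis
    using chart_inv_map[OF assms(1), of x] by simp
qed

lemma open_chart_image:
  assumes "c \<in> A" "open V" "V \<subseteq> chart_dom c"
  shows "open (chart_map c ` V)"
proof -
  have "chart_map c ` V = chart_img c \<inter> chart_inv c -` V"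
  proof (intro equalityI subsetI)
    show "y \<in> chart_img c \<inter> chart_inv c -` V" if "y \<in> chart_map c ` V" for y
      using that assms(3) chart_inv_in[OF assms(1), of y V] by (auto simp: Int_absorb1)
    show "y \<in> chart_map c ` V" if "y \<in> chart_img c \<inter> chart_inv c -` V" for y
      using that by (intro image_eqI[where x = "chart_inv c y"]) (simp_all add: chart_map_inv)
  qed
  moreover have "open (chart_img c \<inter> chart_inv c -` V)"
    by (rule continuous_open_preimage[OF homeomorphism_cont2[OF chart_homeomorphism] open_chart_img])
      (rule assms)+
  ultimately show ?thesis by (simp only:)
qed

lemma open_chart_inv_image:
  assumes "c \<in> A" "open P" "P \<subseteq> chart_img c"
  shows "open (chart_inv c ` P)"
proof -
  have "chart_inv c ` P = chart_dom c \<inter> chart_map c -` P"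
  proof (intro equalityI subsetI)
    fix x assume "x \<in> chart_inv c ` P"
    then obtain y where "y \<in> P" "x = chart_inv c y" by blast
    then show "x \<in> chart_dom c \<inter> chart_map c -` P"
      using subsetD[OF assms(3), of y] chart_map_inv[of y c] chart_inv_in_dom[of y c] by simp
  next
    fix x assume "x \<in> chart_dom c \<inter> chart_map c -` P"
    then show "x \<in> chart_inv c ` P"
      by (intro image_eqI[where x = "chart_map c x"]) (simp_all add: chart_inv_map[OF assms(1)])
  qed
  moreover have "open (chart_dom c \<inter> chart_map c -` P)"
    by (rule continuous_open_preimage[OF homeomorphism_cont1[OF chart_homeomorphism] open_chart_dom])
      (rule assms)+
  ultimately show ?thesis by (simp only:)
qed

lemma Ck_on_1_transition:
  assumes "c \<in> A" "c' \<in> A"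
  shows "Ck_on 1 (chart_map c ` (chart_dom c \<inter> chart_dom c')) (transition c c')"
  using smooth_atlas assms unfolding smooth_atlas_def smooth_on_def by blast

text \<open>Regularity needs checking in a single chart only, because every other chart is reached
  through a \<open>C1\<close> transition map. All local diffeomorphisms constructed below from
  coordinate expressions come from this criterion.\<close>

lemma local_diffeo_on_chart_inv_image:
  assumes c: "c \<in> A" and P: "P \<subseteq> chart_img c" and d: "diffeo P Q H G"
    and h: "\<And>y. y \<in> P \<Longrightarrow> h (chart_inv c y) = H y"
  shows "local_diffeo_on A (chart_inv c ` P) h"
proof -
  let ?V = "chart_inv c ` P" and ?k = "chart_inv c \<circ> G"
  have d': "open P" "open Q" "homeomorphism P Q H G" "Ck_on 1 P H" "Ck_on 1 Q G"
    using d by (auto simp: diffeo_def)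
  have V_dom: "?V \<subseteq> chart_dom c"
    using P by (intro image_subsetI chart_inv_in_dom) (rule subsetD)
  have map_inv: "chart_map c (chart_inv c y) = y" if "y \<in> P" for y
    using P that by (intro chart_map_inv) blast
  have map_V: "chart_map c x \<in> P" if "x \<in> ?V" for x
    using that by (elim imageE) (simp add: map_inv)
  have hV: "h x = H (chart_map c x)" if "x \<in> ?V" for x
    using that by (elim imageE) (simp add: map_inv h)
  have homeo_c: "homeomorphism ?V P (chart_map c) (chart_inv c)"
  proof (rule homeomorphism_of_subsets[OF chart_homeomorphism[OF c] V_dom P])
    show "chart_map c ` ?V = P"
      by (simp add: image_image map_inv)
  qed
  have homeo: "homeomorphism ?V Q h ?k"
    using homeomorphism_compose[OF homeo_c d'(3)]
    by (rule homeomorphism_cong) (simp_all only: o_apply hV)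
  then have hVQ: "h ` ?V = Q" by (rule homeomorphism_image1)
  have "Ck_from 1 A ?V h"
    unfolding Ck_from_def
  proof
    fix c' assume c': "c' \<in> A"
    let ?S = "chart_map c' ` (chart_dom c' \<inter> ?V)"
    have inv: "chart_inv c' y \<in> ?V" if "y \<in> ?S" for y
      by (rule chart_inv_in[OF c' that])
    have S: "open ?S"
      by (intro open_chart_image c' open_Int open_chart_dom open_chart_inv_image c d' P) simp
    \<comment> \<open>On \<open>?S\<close>, this is the expression of \<open>h\<close> in the chart
      \<open>c'\<close>.\<close>
    have "Ck_on 1 ?S (H \<circ> transition c' c)"
    proof (rule Ck_on_1_compose[OF Ck_on_1_subset[OF Ck_on_1_transition[OF c' c]] d'(4)])
      show "?S \<subseteq> chart_map c' ` (chart_dom c' \<inter> chart_dom c)"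
        using V_dom by blast
      show "transition c' c ` ?S \<subseteq> P"
        using inv map_V unfolding transition_def by (metis comp_apply image_subsetI)
    qed
    then show "Ck_on 1 ?S (h \<circ> chart_inv c')"
      by (rule Ck_on_1_cong[OF _ S subset_refl]) (simp add: transition_def hV inv del: image_iff)
  qed
  moreover have "Ck_into 1 A Q ?k"
    unfolding Ck_into_def
  proof (intro conjI ballI)
    show "continuous_on Q ?k"
      using homeo by (rule homeomorphism_cont2)
    fix c' assume c': "c' \<in> A"
    let ?S = "{y \<in> Q. ?k y \<in> chart_dom c'}"
    have "Ck_on 1 ?S (transition c c' \<circ> G)"
    proof (rule Ck_on_1_compose[OF Ck_on_1_subset[OF d'(5)] Ck_on_1_transition[OF c c']])
      show "G ` ?S \<subseteq> chart_map c ` (chart_dom c \<inter> chart_dom c')"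
      proof (rule image_subsetI)
        fix y assume y: "y \<in> ?S"
        then have "G y \<in> chart_img c"
          using P d'(3) by (auto simp: homeomorphism_def)
        then show "G y \<in> chart_map c ` (chart_dom c \<inter> chart_dom c')"
          using y by (intro image_eqI[where x = "chart_inv c (G y)"])
            (simp_all add: chart_map_inv chart_inv_in_dom)
      qed
    qed blast
    then show "Ck_on 1 ?S (chart_map c' \<circ> ?k)"
      by (simp only: transition_def o_assoc)
  qed
  \<comment> \<open>The single neighbourhood \<open>?V\<close> with inverse \<open>?k\<close> serves
    all points at once.\<close>
  ultimately show ?thesis
    using homeo d'(2) open_chart_inv_image[OF c d'(1) P]
    unfolding local_diffeo_on_def hVQ[symmetric] by blast
qed

text \<open>Read in \<open>c\<close> itself, the chart map is the identity of
  \<open>chart_img c\<close>.\<close>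

lemma local_diffeo_on_chart_map:
  assumes "c \<in> A"
  shows "local_diffeo_on A (chart_dom c) (chart_map c)"
proof -
  have "local_diffeo_on A (chart_inv c ` chart_img c) (chart_map c)"
    by (rule local_diffeo_on_chart_inv_image[OF assms subset_refl, where Q = "chart_img c" and H = "\<lambda>y. y" and G = "\<lambda>y. y"])
      (simp_all only: diffeo_def open_chart_img[OF assms] homeomorphism_ident Ck_on_1_ident chart_map_inv simp_thms)
  then show ?thesis
    by (simp only: homeomorphism_image2[OF chart_homeomorphism[OF assms]])
qed

lemma local_diffeo_on_cong:
  assumes "local_diffeo_on A U h" "\<And>x. x \<in> U \<Longrightarrow> h x = h' x"
  shows "local_diffeo_on A U h'"
  unfolding local_diffeo_on_def
proof
  fix x assume "x \<in> U"
  then obtain V k where V: "open V" "x \<in> V" "V \<subseteq> U" "open (h ` V)" "homeomorphism V (h ` V) h k"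
    "Ck_from 1 A V h" "Ck_into 1 A (h ` V) k"
    using assms(1) unfolding local_diffeo_on_def by meson
  have eq: "h y = h' y" if "y \<in> V" for y
    using assms(2) V(3) that by blast
  have img: "h ` V = h' ` V"
    using eq by (rule image_cong[OF refl])
  have "homeomorphism V (h ` V) h' k"
    using V(5) by (rule homeomorphism_cong) (simp_all add: eq)
  moreover have "Ck_from 1 A V h'"
    unfolding Ck_from_def
  proof
    fix c assume c: "c \<in> A"
    have inv: "chart_inv c y \<in> V" if "y \<in> chart_map c ` (chart_dom c \<inter> V)" for y
      by (rule chart_inv_in[OF c that])
    show "Ck_on 1 (chart_map c ` (chart_dom c \<inter> V)) (h' \<circ> chart_inv c)"
    proof (rule Ck_on_1_cong[OF _ _ subset_refl])
      show "Ck_on 1 (chart_map c ` (chart_dom c \<inter> V)) (h \<circ> chart_inv c)"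
        using V(6) c unfolding Ck_from_def by blast
      show "open (chart_map c ` (chart_dom c \<inter> V))"
        by (intro open_chart_image c open_Int open_chart_dom V) simp
      show "(h \<circ> chart_inv c) y = (h' \<circ> chart_inv c) y"
        if "y \<in> chart_map c ` (chart_dom c \<inter> V)" for y
        using eq[OF inv[OF that]] by (simp only: o_apply)
    qed
  qed
  ultimately show "\<exists>V k. open V \<and> x \<in> V \<and> V \<subseteq> U \<and> open (h' ` V) \<and> homeomorphism V (h' ` V) h' k \<and>
      Ck_from 1 A V h' \<and> Ck_into 1 A (h' ` V) k"
    using V img by metis
qed

end


section \<open>Pulling back local diffeomorphisms\<close>

context atlas
begin

definition C1_map :: "('m \<Rightarrow> 'm) \<Rightarrow> bool" where
  "C1_map T \<longleftrightarrow> (\<forall>c\<in>A. \<forall>c'\<in>A.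
     Ck_on 1 {y \<in> chart_img c. T (chart_inv c y) \<in> chart_dom c'} (chart_map c' \<circ> T \<circ> chart_inv c))"

text \<open>Regularity is asked only on some nonempty open part of each \<open>N\<close>, since
  \<open>h \<circ> Q\<close> may fail to be regular at critical points. This weak form is enough for
  a density argument, passes to iterates of homeomorphisms, and also holds for the inverse of
  \<open>T\<close>.\<close>

definition pulls_back_local_diffeos :: "('m \<Rightarrow> 'm) \<Rightarrow> bool" where
  "pulls_back_local_diffeos Q \<longleftrightarrow>
     (\<forall>(h :: 'm \<Rightarrow> real ^ 'n) U N. local_diffeo_on A U h \<and> open N \<and> N \<noteq> {} \<and> Q ` N \<subseteq> U \<longrightarrow>
        (\<exists>N'\<subseteq>N. open N' \<and> N' \<noteq> {} \<and> local_diffeo_on A N' (h \<circ> Q)))"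

lemma pulls_back_local_diffeosD:
  fixes h :: "'m \<Rightarrow> real ^ 'n"
  assumes "pulls_back_local_diffeos Q" "local_diffeo_on A U h" "open N" "N \<noteq> {}" "Q ` N \<subseteq> U"
  obtains N' where "N' \<subseteq> N" "open N'" "N' \<noteq> {}" "local_diffeo_on A N' (h \<circ> Q)"
  using assms unfolding pulls_back_local_diffeos_def by meson

lemma local_diffeo_onE:
  fixes h :: "'m \<Rightarrow> real ^ 'n"
  assumes "local_diffeo_on A U h" "x \<in> U"
  obtains V k where "open V" "x \<in> V" "V \<subseteq> U" "open (h ` V)" "homeomorphism V (h ` V) h k"
    "Ck_from 1 A V h" "Ck_into 1 A (h ` V) k"
  using assms unfolding local_diffeo_on_def by meson

text \<open>In a chart, and where \<open>h\<close> is injective, \<open>h \<circ> T\<close> is an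
  injective \<open>C1\<close> map between spaces of equal dimension, hence a diffeomorphism on some
  open part.\<close>

lemma pulls_back_local_diffeos_forward:
  assumes T: "C1_map T" "continuous_on UNIV T" "inj T"
  shows "pulls_back_local_diffeos T"
  unfolding pulls_back_local_diffeos_def
proof (intro allI impI, elim conjE)
  fix h :: "'m \<Rightarrow> real ^ 'n" and U N
  assume h: "local_diffeo_on A U h" and N: "open N" "N \<noteq> {}" "T ` N \<subseteq> U"
  obtain x where x: "x \<in> N" using N(2) by blast
  then have "T x \<in> U" using N(3) by blast
  then obtain V k where V: "open V" "T x \<in> V" "homeomorphism V (h ` V) h k" "Ck_from 1 A V h"
    using local_diffeo_onE[OF h] by metis
  obtain c where c: "c \<in> A" "x \<in> chart_dom c" by (rule chart_around)
  obtain c' where c': "c' \<in> A" "T x \<in> chart_dom c'" by (rule chart_around)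
  \<comment> \<open>\<open>N\<close> is shrunk so that one source chart and one target chart suffice
    and \<open>T\<close> lands where \<open>h\<close> has the inverse \<open>k\<close>.\<close>
  define N1 where "N1 = N \<inter> chart_dom c \<inter> T -` (V \<inter> chart_dom c')"
  have N1: "open N1" "x \<in> N1" "N1 \<subseteq> chart_dom c" "N1 \<subseteq> N"
    "\<And>z. z \<in> N1 \<Longrightarrow> T z \<in> V" "\<And>z. z \<in> N1 \<Longrightarrow> T z \<in> chart_dom c'"
    unfolding N1_def using x c c' V N open_chart_dom[OF c(1)] open_chart_dom[OF c'(1)]
    by (auto intro!: open_Int open_vimage[OF _ T(2)])
  let ?\<Omega> = "chart_map c ` N1" and ?F = "h \<circ> T \<circ> chart_inv c"
  have inv: "chart_inv c y \<in> N1" if "y \<in> ?\<Omega>" for y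
    using chart_inv_in[OF c(1), of y N1] that N1(3) by (simp add: Int_absorb1)
  have \<Omega>_img: "?\<Omega> \<subseteq> chart_img c" using N1(3) by (rule image_mono)
  have \<Omega>: "open ?\<Omega>" "?\<Omega> \<noteq> {}"
    using open_chart_image[OF c(1) N1(1,3)] N1(2) by auto
  have "inj_on ?F ?\<Omega>"
  proof (rule inj_onI)
    fix y z assume y: "y \<in> ?\<Omega>" and z: "z \<in> ?\<Omega>" and eq: "?F y = ?F z"
    have "k (h (T (chart_inv c y))) = k (h (T (chart_inv c z)))"
      using eq unfolding o_apply by (rule arg_cong)
    then have "T (chart_inv c y) = T (chart_inv c z)"
      unfolding homeomorphism_apply1[OF V(3) N1(5)[OF inv[OF y]]]
        homeomorphism_apply1[OF V(3) N1(5)[OF inv[OF z]]] .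
    then have "chart_inv c y = chart_inv c z" using T(3) by (rule injD[rotated])
    then show "y = z"
      by (rule inv_into_injective[OF _ subsetD[OF \<Omega>_img y] subsetD[OF \<Omega>_img z]])
  qed
  moreover have "Ck_on 1 ?\<Omega> ?F"
  proof (rule Ck_on_1_cong[OF _ \<Omega>(1) subset_refl])
    \<comment> \<open>Passing through the chart \<open>c'\<close> splits \<open>h \<circ> T\<close>
      into two coordinate expressions, each known to be \<open>C1\<close>.\<close>
    show "Ck_on 1 ?\<Omega> ((h \<circ> chart_inv c') \<circ> (chart_map c' \<circ> T \<circ> chart_inv c))"
    proof (rule Ck_on_1_compose)
      show "Ck_on 1 ?\<Omega> (chart_map c' \<circ> T \<circ> chart_inv c)"
      proof (rule Ck_on_1_subset)
        show "Ck_on 1 {y \<in> chart_img c. T (chart_inv c y) \<in> chart_dom c'} (chart_map c' \<circ> T \<circ> chart_inv c)"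
          using T(1) c(1) c'(1) unfolding C1_map_def by blast
        show "?\<Omega> \<subseteq> {y \<in> chart_img c. T (chart_inv c y) \<in> chart_dom c'}"
          using \<Omega>_img by (intro subsetI CollectI conjI N1(6) inv) (rule subsetD)
      qed
      show "Ck_on 1 (chart_map c' ` (chart_dom c' \<inter> V)) (h \<circ> chart_inv c')"
        using V(4) c'(1) unfolding Ck_from_def by blast
      show "(chart_map c' \<circ> T \<circ> chart_inv c) ` ?\<Omega> \<subseteq> chart_map c' ` (chart_dom c' \<inter> V)"
        unfolding o_apply by (intro image_subsetI imageI IntI N1(5,6) inv)
    qed
    show "((h \<circ> chart_inv c') \<circ> (chart_map c' \<circ> T \<circ> chart_inv c)) y = ?F y" if "y \<in> ?\<Omega>" for y
      using chart_inv_map[OF c'(1) N1(6)[OF inv[OF that]]] by (simp only: o_apply)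
  qed
  ultimately obtain P Q G where P: "P \<subseteq> ?\<Omega>" "P \<noteq> {}" "diffeo P Q ?F G"
    by (rule injective_Ck_on_1_imp_diffeo_somewhere[OF \<Omega>])
  have P_img: "P \<subseteq> chart_img c" using P(1) \<Omega>_img by (rule subset_trans)
  have "local_diffeo_on A (chart_inv c ` P) (h \<circ> T)"
    by (rule local_diffeo_on_chart_inv_image[OF c(1) P_img P(3)]) (simp only: o_apply)
  moreover have "open (chart_inv c ` P)"
    using P(3) by (intro open_chart_inv_image c P_img) (simp only: diffeo_def)
  moreover have "chart_inv c ` P \<subseteq> N"
    by (intro image_subsetI subsetD[OF N1(4)] inv subsetD[OF P(1)])
  ultimately show "\<exists>N'\<subseteq>N. open N' \<and> N' \<noteq> {} \<and> local_diffeo_on A N' (h \<circ> T)"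
    using P(2) by (metis image_is_empty)
qed

text \<open>The inverse \<open>S\<close> need not be differentiable. Instead, \<open>T\<close> is inverted near a point where
  its derivative in the coordinates \<open>h\<close> is regular.\<close>

lemma pulls_back_local_diffeos_backward:
  assumes T: "C1_map T" and TS: "homeomorphism UNIV UNIV T S"
  shows "pulls_back_local_diffeos S"
  unfolding pulls_back_local_diffeos_def
proof (intro allI impI, elim conjE)
  fix h :: "'m \<Rightarrow> real ^ 'n" and U N
  assume h: "local_diffeo_on A U h" and N: "open N" "N \<noteq> {}" "S ` N \<subseteq> U"
  have ST: "S (T x) = x" "T (S x) = x" for x
    using TS by (simp_all add: homeomorphism_def)
  have T_cont: "continuous_on UNIV T" using TS by (rule homeomorphism_cont1)
  obtain x where x: "x \<in> N" using N(2) by blast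
  then have "S x \<in> U" using N(3) by blast
  then obtain V k where V: "open V" "S x \<in> V" "open (h ` V)" "homeomorphism V (h ` V) h k"
    "Ck_into 1 A (h ` V) k"
    using local_diffeo_onE[OF h] by metis
  obtain c where c: "c \<in> A" "S x \<in> chart_dom c" by (rule chart_around)
  obtain c' where c': "c' \<in> A" "x \<in> chart_dom c'" by (rule chart_around)
  let ?N1 = "chart_dom c \<inter> T -` (N \<inter> chart_dom c')"
  \<comment> \<open>The construction runs in the value space of \<open>h\<close>. On
    \<open>\<Omega>\<close> the map \<open>chart_map c' \<circ> T \<circ> k\<close> is
    \<open>C1\<close> and injective, and where it is a diffeomorphism its inverse is
    \<open>h \<circ> S\<close> read in \<open>c'\<close>.\<close>
  define \<Omega> where "\<Omega> = h ` V \<inter> k -` ?N1"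
  have hk: "k (h z) = z" if "z \<in> V" for z
    by (rule homeomorphism_apply1[OF V(4) that])
  have kh: "h (k y) = y" if "y \<in> \<Omega>" for y
    using that by (intro homeomorphism_apply2[OF V(4)]) (simp add: \<Omega>_def)
  have \<Omega>D: "y \<in> h ` V" "k y \<in> chart_dom c" "T (k y) \<in> N" "T (k y) \<in> chart_dom c'" if "y \<in> \<Omega>" for y
    using that by (simp_all add: \<Omega>_def)
  have "open ?N1"
    using open_chart_dom[OF c(1)] open_chart_dom[OF c'(1)] N(1)
    by (intro open_Int open_vimage[OF _ T_cont])
  then have "open \<Omega>"
    unfolding \<Omega>_def by (intro continuous_open_preimage[OF homeomorphism_cont2[OF V(4)] V(3)])
  moreover have "h (S x) \<in> \<Omega>"
    unfolding \<Omega>_def using hk[OF V(2)] V(2) c c' x ST by simp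
  then have "\<Omega> \<noteq> {}" by blast
  moreover let ?F = "chart_map c' \<circ> T \<circ> k"
  have "inj_on ?F \<Omega>"
  proof (rule inj_onI)
    fix y z assume y: "y \<in> \<Omega>" and z: "z \<in> \<Omega>" and eq: "?F y = ?F z"
    have "chart_inv c' (?F y) = chart_inv c' (?F z)" using eq by (rule arg_cong)
    then have "T (k y) = T (k z)"
      unfolding o_apply chart_inv_map[OF c'(1) \<Omega>D(4)[OF y]] chart_inv_map[OF c'(1) \<Omega>D(4)[OF z]] .
    then have "S (T (k y)) = S (T (k z))" by (rule arg_cong)
    then have "k y = k z" unfolding ST .
    then have "h (k y) = h (k z)" by (rule arg_cong)
    then show "y = z" unfolding kh[OF y] kh[OF z] .
  qed
  moreover have "Ck_on 1 \<Omega> ?F"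
  proof (rule Ck_on_1_cong[OF _ \<open>open \<Omega>\<close> subset_refl])
    show "Ck_on 1 \<Omega> ((chart_map c' \<circ> T \<circ> chart_inv c) \<circ> (chart_map c \<circ> k))"
    proof (rule Ck_on_1_compose)
      have "Ck_on 1 {y \<in> h ` V. k y \<in> chart_dom c} (chart_map c \<circ> k)"
        using V(5) c(1) unfolding Ck_into_def by blast
      then show "Ck_on 1 \<Omega> (chart_map c \<circ> k)"
        by (rule Ck_on_1_subset) (intro subsetI CollectI conjI \<Omega>D)
      show "Ck_on 1 {y \<in> chart_img c. T (chart_inv c y) \<in> chart_dom c'} (chart_map c' \<circ> T \<circ> chart_inv c)"
        using T c(1) c'(1) unfolding C1_map_def by blast
      show "(chart_map c \<circ> k) ` \<Omega> \<subseteq> {y \<in> chart_img c. T (chart_inv c y) \<in> chart_dom c'}"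
        using \<Omega>D by (intro image_subsetI CollectI conjI) (simp_all add: chart_inv_map[OF c(1)])
    qed
    show "((chart_map c' \<circ> T \<circ> chart_inv c) \<circ> (chart_map c \<circ> k)) y = ?F y" if "y \<in> \<Omega>" for y
      using chart_inv_map[OF c(1) \<Omega>D(2)[OF that]] by (simp only: o_apply)
  qed
  ultimately obtain P Q G where P: "P \<subseteq> \<Omega>" "P \<noteq> {}" "diffeo P Q ?F G"
    by (rule injective_Ck_on_1_imp_diffeo_somewhere)
  have PQ: "homeomorphism P Q ?F G" "open Q" using P(3) by (simp_all only: diffeo_def)
  have chart_inv_F: "chart_inv c' (?F y) = T (k y)" if "y \<in> P" for y
    using chart_inv_map[OF c'(1) \<Omega>D(4)[OF subsetD[OF P(1) that]]] by (simp only: o_apply)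
  have Q: "\<exists>z\<in>P. y = ?F z" if "y \<in> Q" for y
    using that unfolding homeomorphism_image1[OF PQ(1), symmetric] by blast
  have Q_img: "Q \<subseteq> chart_img c'"
  proof
    fix y assume "y \<in> Q"
    then obtain z where z: "z \<in> P" "y = ?F z" using Q by blast
    then show "y \<in> chart_img c'"
      using imageI[OF \<Omega>D(4)[OF subsetD[OF P(1) z(1)]], of "chart_map c'"] by (simp only: o_apply)
  qed
  have "local_diffeo_on A (chart_inv c' ` Q) (h \<circ> S)"
  proof (rule local_diffeo_on_chart_inv_image[OF c'(1) Q_img diffeo_sym[OF P(3)]])
    fix y assume "y \<in> Q"
    then obtain z where z: "z \<in> P" "y = ?F z" using Q by blast
    then have "(h \<circ> S) (chart_inv c' y) = h (k z)"
      by (simp only: chart_inv_F o_apply[of h S] ST)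
    then show "(h \<circ> S) (chart_inv c' y) = G y"
      using homeomorphism_apply1[OF PQ(1) z(1)] z(2) kh[OF subsetD[OF P(1) z(1)]] by simp
  qed
  moreover have "open (chart_inv c' ` Q)"
    by (intro open_chart_inv_image c' Q_img PQ)
  moreover have "chart_inv c' ` Q \<subseteq> N"
  proof (rule image_subsetI)
    fix y assume "y \<in> Q"
    then obtain z where z: "z \<in> P" "y = ?F z" using Q by blast
    then show "chart_inv c' y \<in> N"
      using chart_inv_F[OF z(1)] \<Omega>D(3)[OF subsetD[OF P(1) z(1)]] by (simp only:)
  qed
  moreover have "Q \<noteq> {}"
    using P(2) homeomorphism_image1[OF PQ(1)] by blast
  ultimately show "\<exists>N'\<subseteq>N. open N' \<and> N' \<noteq> {} \<and> local_diffeo_on A N' (h \<circ> S)"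
    by (metis image_is_empty)
qed

lemma pulls_back_local_diffeos_funpow:
  assumes Q: "pulls_back_local_diffeos Q" and Q': "homeomorphism UNIV UNIV Q Q'"
  shows "pulls_back_local_diffeos (Q ^^ n)"
proof (induction n)
  case 0
  \<comment> \<open>The coordinate expressions of the identity are the transition maps.\<close>
  have "C1_map (\<lambda>x. x)"
    unfolding C1_map_def
  proof (intro ballI)
    fix c c' assume c: "c \<in> A" "c' \<in> A"
    show "Ck_on 1 {y \<in> chart_img c. chart_inv c y \<in> chart_dom c'} (chart_map c' \<circ> (\<lambda>x. x) \<circ> chart_inv c)"
    proof (rule Ck_on_1_subset)
      show "Ck_on 1 (chart_map c ` (chart_dom c \<inter> chart_dom c')) (chart_map c' \<circ> (\<lambda>x. x) \<circ> chart_inv c)"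
        using Ck_on_1_transition[OF c] by (simp only: transition_def comp_def)
    next
      show "{y \<in> chart_img c. chart_inv c y \<in> chart_dom c'} \<subseteq> chart_map c ` (chart_dom c \<inter> chart_dom c')"
      proof
        fix y assume y: "y \<in> {y \<in> chart_img c. chart_inv c y \<in> chart_dom c'}"
        then show "y \<in> chart_map c ` (chart_dom c \<inter> chart_dom c')"
          by (intro image_eqI[where x = "chart_inv c y"]) (simp_all add: chart_map_inv chart_inv_in_dom)
      qed
    qed
  qed
  then have "pulls_back_local_diffeos (\<lambda>x. x)"
    by (rule pulls_back_local_diffeos_forward) simp_all
  then show ?case by (simp add: id_def)
next
  case (Suc n)
  show ?case
    unfolding pulls_back_local_diffeos_def
  proof (intro allI impI, elim conjE)
    fix h :: "'m \<Rightarrow> real ^ 'n" and U N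
    assume h: "local_diffeo_on A U h" and N: "open N" "N \<noteq> {}" "(Q ^^ Suc n) ` N \<subseteq> U"
    have QN: "open (Q ` N)"
      using homeomorphism_imp_open_map[OF Q'] N(1) by simp
    have "Q ` N \<noteq> {}" "(Q ^^ n) ` Q ` N \<subseteq> U"
      using N(2,3) by (auto simp: funpow_swap1)
    then obtain N1 where N1: "N1 \<subseteq> Q ` N" "open N1" "N1 \<noteq> {}" "local_diffeo_on A N1 (h \<circ> Q ^^ n)"
      by (rule pulls_back_local_diffeosD[OF Suc.IH h QN])
    have "open (N \<inter> Q -` N1)"
      using N(1) N1(2) homeomorphism_cont1[OF Q'] by (intro open_Int open_vimage)
    moreover have "N \<inter> Q -` N1 \<noteq> {}" using N1(1,3) by blast
    moreover have "Q ` (N \<inter> Q -` N1) \<subseteq> N1" by blast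
    ultimately obtain N2 where "N2 \<subseteq> N \<inter> Q -` N1" "open N2" "N2 \<noteq> {}"
      "local_diffeo_on A N2 (h \<circ> Q ^^ n \<circ> Q)"
      by (rule pulls_back_local_diffeosD[OF Q N1(4)])
    then show "\<exists>N'\<subseteq>N. open N' \<and> N' \<noteq> {} \<and> local_diffeo_on A N' (h \<circ> Q ^^ Suc n)"
      unfolding funpow_Suc_right o_assoc by blast
  qed
qed

end


section \<open>The gradient descent map in charts\<close>

context atlas
begin

section \<open>Transition derivatives and tangent vectors in coordinates\<close>

lemma open_chart_overlap:
  "c \<in> A \<Longrightarrow> c' \<in> A \<Longrightarrow> open (chart_map c ` (chart_dom c \<inter> chart_dom c'))"
  by (intro open_chart_image open_Int open_chart_dom) auto

abbreviation transition_deriv where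
  "transition_deriv x c c' \<equiv> frechet_derivative (transition c c') (at (chart_map c x))"

lemma transition_has_derivative:
  assumes "c \<in> A" "c' \<in> A" "x \<in> chart_dom c" "x \<in> chart_dom c'"
  shows "(transition c c' has_derivative transition_deriv x c c') (at (chart_map c x))"
proof -
  have "chart_map c x \<in> chart_map c ` (chart_dom c \<inter> chart_dom c')"
    using assms(3,4) by simp
  moreover obtain D where "\<And>y. y \<in> chart_map c ` (chart_dom c \<inter> chart_dom c') \<Longrightarrow>
      (transition c c' has_derivative D y) (at y)"
    using Ck_on_1E[OF Ck_on_1_transition[OF assms(1,2)]] by metis
  ultimately have "transition c c' differentiable (at (chart_map c x))"
    unfolding differentiable_def by blast
  then show ?thesis
    by (simp add: frechet_derivative_works)
qed

lemma transition_deriv_linear: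
  assumes "c \<in> A" "c' \<in> A" "x \<in> chart_dom c" "x \<in> chart_dom c'"
  shows "linear (transition_deriv x c c')"
  using transition_has_derivative[OF assms] by (rule has_derivative_linear)

lemma chart_inv_near:
  assumes "c \<in> A" "c' \<in> A" "y \<in> chart_map c ` (chart_dom c \<inter> chart_dom c')"
  shows "chart_inv c' (transition c c' y) = chart_inv c y"
  using chart_inv_map[OF assms(2) chart_inv_in[OF assms(1,3)]] by (simp only: transition_def o_apply)

lemma transition_map:
  assumes "c \<in> A" "x \<in> chart_dom c"
  shows "transition c c' (chart_map c x) = chart_map c' x"
  using chart_inv_map[OF assms] by (simp only: transition_def o_apply)

text \<open>The chain rule for \<open>(h \<circ> chart_inv c') \<circ> transition c c'\<close>,
  which agrees with \<open>h \<circ> chart_inv c\<close> on the overlap. Real-valued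
  \<open>h\<close> gives chart independence of the differential, and
  \<open>h = chart_map c''\<close> gives the cocycle rule for transition derivatives.\<close>

lemma frechet_derivative_change_chart:
  assumes c: "c \<in> A" "c' \<in> A" "x \<in> chart_dom c" "x \<in> chart_dom c'"
    and h: "(h \<circ> chart_inv c') differentiable (at (chart_map c' x))"
  shows "frechet_derivative (h \<circ> chart_inv c) (at (chart_map c x)) v =
    frechet_derivative (h \<circ> chart_inv c') (at (chart_map c' x)) (transition_deriv x c c' v)"
proof -
  let ?D = "frechet_derivative (h \<circ> chart_inv c') (at (chart_map c' x))"
  have "(h \<circ> chart_inv c' has_derivative ?D) (at (transition c c' (chart_map c x)))"
    unfolding transition_map[OF c(1,3)] using h by (simp add: frechet_derivative_works)
  then have "((h \<circ> chart_inv c') \<circ> transition c c' has_derivative ?D \<circ> transition_deriv x c c')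
      (at (chart_map c x))"
    by (rule diff_chain_at[OF transition_has_derivative[OF c]])
  then have "(h \<circ> chart_inv c has_derivative ?D \<circ> transition_deriv x c c') (at (chart_map c x))"
  proof (rule has_derivative_transform_within_open[OF _ open_chart_overlap[OF c(1,2)]])
    show "chart_map c x \<in> chart_map c ` (chart_dom c \<inter> chart_dom c')"
      using c(3,4) by simp
  qed (simp only: o_apply chart_inv_near[OF c(1,2)])
  then show ?thesis
    using frechet_derivative_at by (metis o_apply)
qed

lemma transition_deriv_trans:
  assumes "c \<in> A" "c' \<in> A" "c'' \<in> A" "x \<in> chart_dom c" "x \<in> chart_dom c'" "x \<in> chart_dom c''"
  shows "transition_deriv x c c'' v = transition_deriv x c' c'' (transition_deriv x c c' v)"
  unfolding transition_def[of c c''] transition_def[of c' c'']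
proof (rule frechet_derivative_change_chart)
  show "(chart_map c'' \<circ> chart_inv c') differentiable (at (chart_map c' x))"
    using transition_has_derivative[OF assms(2,3,5,6)]
    unfolding differentiable_def transition_def[symmetric] by blast
qed (fact assms)+

lemma transition_deriv_self:
  assumes "c \<in> A" "x \<in> chart_dom c"
  shows "transition_deriv x c c v = v"
proof -
  have "((\<lambda>y. y) has_derivative (\<lambda>v. v)) (at (chart_map c x))" by simp
  then have "(transition c c has_derivative (\<lambda>v. v)) (at (chart_map c x))"
    by (rule has_derivative_transform_within_open[OF _ open_chart_img[OF assms(1)]])
      (use assms in \<open>simp_all add: transition_def chart_map_inv\<close>)
  then show ?thesis
    using frechet_derivative_at by metis
qed

lemma tvec_of_tangent:
  assumes "c \<in> A" "x \<in> chart_dom c"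
  shows "tvec_of A x c w \<in> tangent_space A x"
  unfolding tangent_space_def
proof (intro CollectI conjI allI ballI impI)
  show "tvec_of A x c w c' = 0" if "c' \<notin> A \<or> x \<notin> chart_dom c'" for c'
    using that by (auto simp: tvec_of_def)
  fix c' c'' assume c': "c' \<in> A" "c'' \<in> A" "x \<in> chart_dom c' \<inter> chart_dom c''"
  then show "tvec_of A x c w c'' = transition_deriv x c' c'' (tvec_of A x c w c')"
    using transition_deriv_trans[OF assms(1) c'(1,2) assms(2), of w] by (simp add: tvec_of_def)
qed

lemma tvec_of_self:
  assumes "c \<in> A" "x \<in> chart_dom c"
  shows "tvec_of A x c w c = w"
  using assms by (simp add: tvec_of_def transition_deriv_self)

text \<open>The compatibility condition determines all components from the one in \<open>c\<close>.
  With \<open>tvec_of_self\<close>, this identifies the tangent space with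
  \<open>real ^ 'n\<close>.\<close>

lemma tangent_eq_tvec_of:
  assumes "c \<in> A" "x \<in> chart_dom c" "v \<in> tangent_space A x"
  shows "v = tvec_of A x c (v c)"
proof
  fix c'
  show "v c' = tvec_of A x c (v c) c'"
  proof (cases "c' \<in> A \<and> x \<in> chart_dom c'")
    case True
    then have "v c' = transition_deriv x c c' (v c)"
      using assms unfolding tangent_space_def by blast
    then show ?thesis
      using True by (simp only: tvec_of_def if_True simp_thms)
  next
    case False
    then have "v c' = 0"
      using assms(3) unfolding tangent_space_def by blast
    then show ?thesis
      using False by (simp only: tvec_of_def if_False)
  qed
qed

lemma tvec_of_linear:
  assumes "c \<in> A" "x \<in> chart_dom c"
  shows "tvec_of A x c (a *\<^sub>R v + b *\<^sub>R w) =
    (\<lambda>c'. a *\<^sub>R tvec_of A x c v c' + b *\<^sub>R tvec_of A x c w c')"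
proof
  fix c'
  show "tvec_of A x c (a *\<^sub>R v + b *\<^sub>R w) c' = a *\<^sub>R tvec_of A x c v c' + b *\<^sub>R tvec_of A x c w c'"
  proof (cases "c' \<in> A \<and> x \<in> chart_dom c'")
    case True
    then have lin: "linear (transition_deriv x c c')"
      using transition_deriv_linear assms by blast
    show ?thesis
      using True by (simp add: tvec_of_def linear_add[OF lin] linear_scale[OF lin])
  qed (auto simp: tvec_of_def)
qed

lemma tvec_of_scaleR:
  assumes "c \<in> A" "x \<in> chart_dom c"
  shows "tvec_of A x c (a *\<^sub>R v) = (\<lambda>c'. a *\<^sub>R tvec_of A x c v c')"
  using tvec_of_linear[OF assms, of a v 0 0] by simp

lemma Ck_from_differentiable:
  assumes "Ck_from (Suc k) A UNIV f" "c \<in> A" "x \<in> chart_dom c"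
  shows "(f \<circ> chart_inv c) differentiable (at (chart_map c x))"
  using assms unfolding Ck_from_def by simp

lemma differential_in_chart:
  fixes f :: "'m \<Rightarrow> real"
  assumes f: "Ck_from (Suc k) A UNIV f" and c: "c \<in> A" "x \<in> chart_dom c" and s: "s \<in> tangent_space A x"
  shows "differential A f x s = frechet_derivative (f \<circ> chart_inv c) (at (chart_map c x)) (s c)"
proof -
  \<comment> \<open>\<open>c0\<close> is the chart chosen inside \<open>differential\<close>; the
    change of chart moves the computation from it to \<open>c\<close>.\<close>
  define c0 where "c0 = (SOME c. c \<in> A \<and> x \<in> chart_dom c)"
  have c0: "c0 \<in> A" "x \<in> chart_dom c0"
    using someI[of "\<lambda>c. c \<in> A \<and> x \<in> chart_dom c"] c unfolding c0_def by blast+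
  have "s c = transition_deriv x c0 c (s c0)"
    using s c c0 unfolding tangent_space_def by blast
  then have "frechet_derivative (f \<circ> chart_inv c0) (at (chart_map c0 x)) (s c0) =
      frechet_derivative (f \<circ> chart_inv c) (at (chart_map c x)) (s c)"
    using frechet_derivative_change_chart[OF c0(1) c(1) c0(2) c(2) Ck_from_differentiable[OF f c]] by simp
  then show ?thesis
    unfolding differential_def Let_def c0_def .
qed

end

section \<open>The metric and the gradient in coordinates\<close>

locale riemannian_atlas = atlas A
  for A :: "('m::{t2_space, second_countable_topology}, real ^ 'n) chart set" +
  fixes g :: "'m \<Rightarrow> ('m, real ^ 'n) tvec \<Rightarrow> ('m, real ^ 'n) tvec \<Rightarrow> real"
  assumes metric: "riemannian_metric A g"
begin

definition metric_form :: "('m, real ^ 'n) chart \<Rightarrow> 'm \<Rightarrow> real ^ 'n \<Rightarrow> real ^ 'n \<Rightarrow> real" where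
  "metric_form c x v w = g x (tvec_of A x c v) (tvec_of A x c w)"

text \<open>The matrix of metric coefficients, usually written \<open>g_ij\<close>, in the chart
  \<open>c\<close>.\<close>

definition gram :: "('m, real ^ 'n) chart \<Rightarrow> 'm \<Rightarrow> real ^ 'n ^ 'n" where
  "gram c x = (\<chi> i j. metric_form c x (axis i 1) (axis j 1))"

context
  fixes c x
  assumes c: "c \<in> A" and x: "x \<in> chart_dom c"
begin

lemma metric_form_comb_left:
  "metric_form c x (a *\<^sub>R u + b *\<^sub>R v) w = a * metric_form c x u w + b * metric_form c x v w"
  using metric tvec_of_tangent[OF c x] unfolding riemannian_metric_def metric_form_def tvec_of_linear[OF c x]
  by blast

lemma metric_form_sym: "metric_form c x v w = metric_form c x w v"
  using metric tvec_of_tangent[OF c x] unfolding riemannian_metric_def metric_form_def by blast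

lemma metric_form_linear: "linear (metric_form c x v)"
proof (rule linearI)
  show "metric_form c x v (b1 + b2) = metric_form c x v b1 + metric_form c x v b2" for b1 b2
    using metric_form_comb_left[of 1 b1 1 b2 v] by (simp add: metric_form_sym)
  show "metric_form c x v (r *\<^sub>R b) = r *\<^sub>R metric_form c x v b" for r b
    using metric_form_comb_left[of r b 0 0 v] by (simp add: metric_form_sym)
qed

lemma metric_form_eq_0D:
  assumes "metric_form c x v v = 0"
  shows "v = 0"
proof (rule ccontr)
  assume "v \<noteq> 0"
  then have "tvec_of A x c v \<noteq> (\<lambda>c. 0)"
    using tvec_of_self[OF c x, of v] by metis
  then have "metric_form c x v v > 0"
    using metric tvec_of_tangent[OF c x] unfolding riemannian_metric_def metric_form_def by blast
  then show False using assms by simp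
qed

lemma gram_vector: "(gram c x *v u) $ i = metric_form c x u (axis i 1)"
proof -
  have "metric_form c x u (axis i 1) = metric_form c x (axis i 1) (\<Sum>j\<in>UNIV. u $ j *\<^sub>R axis j 1)"
    by (simp add: metric_form_sym basis_expansion[of u, unfolded scalar_mult_eq_scaleR])
  also have "\<dots> = (\<Sum>j\<in>UNIV. u $ j * metric_form c x (axis i 1) (axis j 1))"
    by (simp add: linear_sum[OF metric_form_linear] linear_scale[OF metric_form_linear])
  finally show ?thesis
    by (simp add: matrix_vector_mult_def gram_def mult.commute)
qed

lemma metric_form_eqI:
  assumes "linear L" "\<And>i. metric_form c x u (axis i 1) = L (axis i 1)"
  shows "metric_form c x u w = L w"
proof -
  have "metric_form c x u = L"
    by (rule linear_eq_stdbasis[OF metric_form_linear assms(1)]) (auto simp: Basis_vec_def assms(2))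
  then show ?thesis by simp
qed

text \<open>A kernel vector is orthogonal to all axis vectors, hence to itself, and so vanishes by
  positive definiteness.\<close>

lemma det_gram_nonzero: "det (gram c x) \<noteq> 0"
proof -
  have "u = 0" if "gram c x *v u = 0" for u
  proof (rule metric_form_eq_0D)
    have "linear (\<lambda>w. 0 :: real)" by (rule linear_zero)
    then show "metric_form c x u u = 0"
      by (rule metric_form_eqI) (simp add: gram_vector[symmetric] that)
  qed
  then show ?thesis
    using matrix_left_invertible_ker[of "gram c x"] invertible_det_nz invertible_left_inverse by blast
qed

text \<open>The familiar formula for the gradient as inverse metric times differential, stated as a
  linear system so that Cramer's rule yields its regularity.\<close>

lemma riemannian_grad_in_chart:
  assumes f: "Ck_from (Suc k) A UNIV f"
    and u: "gram c x *v u = (\<chi> i. frechet_derivative (f \<circ> chart_inv c) (at (chart_map c x)) (axis i 1))"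
  shows "riemannian_grad A g f x = tvec_of A x c u"
proof -
  let ?D = "frechet_derivative (f \<circ> chart_inv c) (at (chart_map c x))"
  have "linear ?D"
    using Ck_from_differentiable[OF f c x] by (rule linear_frechet_derivative)
  moreover have "metric_form c x u (axis i 1) = ?D (axis i 1)" for i
    using arg_cong[OF u, of "\<lambda>v. v $ i"] by (simp add: gram_vector)
  ultimately have uD: "metric_form c x u w = ?D w" for w
    by (rule metric_form_eqI)
  have diff: "differential A f x s = metric_form c x u (s c)" if "s \<in> tangent_space A x" for s
    using differential_in_chart[OF f c x that] uD by simp
  have form: "g x v s = metric_form c x (v c) (s c)" if "v \<in> tangent_space A x" "s \<in> tangent_space A x" for v s
    unfolding metric_form_def
    by (rule arg_cong2[OF tangent_eq_tvec_of[OF c x that(1)] tangent_eq_tvec_of[OF c x that(2)]])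
  show ?thesis
    unfolding riemannian_grad_def
  proof (rule the_equality)
    show "tvec_of A x c u \<in> tangent_space A x \<and>
        (\<forall>s\<in>tangent_space A x. differential A f x s = g x (tvec_of A x c u) s)"
      using diff form tvec_of_tangent[OF c x] tvec_of_self[OF c x] by simp
  next
    fix v assume v: "v \<in> tangent_space A x \<and> (\<forall>s\<in>tangent_space A x. differential A f x s = g x v s)"
    \<comment> \<open>Uniqueness: two representing vectors give the same pairing with their own
      difference, which therefore has length zero.\<close>
    let ?w = "u - v c"
    have "metric_form c x u ?w = metric_form c x (v c) ?w"
      using v diff[of "tvec_of A x c ?w"] form[of v "tvec_of A x c ?w"]
        tvec_of_tangent[OF c x] tvec_of_self[OF c x] by simp
    then have "metric_form c x ?w ?w = 0"
      using metric_form_comb_left[of 1 u "-1" "v c" ?w] by simp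
    then have "u = v c"
      using metric_form_eq_0D by fastforce
    then show "v = tvec_of A x c u"
      using tangent_eq_tvec_of[OF c x] v by metis
  qed
qed

end

text \<open>One derivative of \<open>f\<close> is spent on the gradient, leaving \<open>C1\<close>
  coefficients. In coordinates \<open>T\<close> is the smooth retraction after the \<open>C1\<close>
  map that attaches the scaled gradient to each point.\<close>

lemma C1_map_gradient_descent_map:
  assumes R: "manifold_retraction A R" and f: "Ck_from 2 A UNIV f"
  shows "C1_map (gradient_descent_map A g R f \<eta>)"
  unfolding C1_map_def
proof (intro ballI)
  fix c c' assume c: "c \<in> A" and c': "c' \<in> A"
  let ?T = "gradient_descent_map A g R f \<eta>"
  let ?D = "\<lambda>y. frechet_derivative (f \<circ> chart_inv c) (at y)"
  define b where "b y = (\<chi> i. ?D y (axis i 1))" for y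
  define M where "M y = gram c (chart_inv c y)" for y
  have dom: "chart_inv c y \<in> chart_dom c" if "y \<in> chart_img c" for y
    using that by (rule chart_inv_in_dom)
  have det: "det (M y) \<noteq> 0" if "y \<in> chart_img c" for y
    unfolding M_def by (rule det_gram_nonzero[OF c dom[OF that]])
  have "\<exists>u. \<forall>y\<in>chart_img c. M y *v u y = b y"
    \<comment> \<open>The solution is chosen pointwise, but as nonsingularity makes it unique, its
      regularity on \<open>chart_img c\<close> follows from that of the coefficients.\<close>
    using cramer[OF det] by (intro bchoice) blast
  then obtain u where Mu: "\<And>y. y \<in> chart_img c \<Longrightarrow> M y *v u y = b y" by blast
  have f2: "Ck_from (Suc 1) A UNIV f" using f by (simp add: numeral_2_eq_2)
  have "Ck_on 1 (chart_img c) u"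
  proof (rule Ck_on_1_linear_system[OF open_chart_img[OF c] _ _ det Mu])
    show "Ck_on 1 (chart_img c) (\<lambda>y. M y $ i $ j)" for i j
      using metric c unfolding riemannian_metric_def M_def gram_def metric_form_def smooth_on_def
        vec_lambda_beta by blast
    show "Ck_on 1 (chart_img c) (\<lambda>y. b y $ i)" for i
      using f2 c unfolding Ck_from_def b_def Ck_on.simps(2)[of 1] by simp
  qed
  then have uC1: "Ck_on 1 (chart_img c) (\<lambda>y. (y, (- \<eta>) *\<^sub>R u y))"
    by (intro Ck_on_1_Pair Ck_on_1_ident Ck_on_1_scaleR_const)
  let ?\<Psi> = "\<lambda>(y, w). R (chart_inv c y) (tvec_of A (chart_inv c y) c w)"
  have T: "?T (chart_inv c y) = ?\<Psi> (y, (- \<eta>) *\<^sub>R u y)" if y: "y \<in> chart_img c" for y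
  proof -
    have "gram c (chart_inv c y) *v u y = (\<chi> i. ?D (chart_map c (chart_inv c y)) (axis i 1))"
      using Mu[OF y] unfolding M_def b_def chart_map_inv[OF y] .
    then have "riemannian_grad A g f (chart_inv c y) = tvec_of A (chart_inv c y) c (u y)"
      by (rule riemannian_grad_in_chart[OF c dom[OF y] f2])
    then show ?thesis
      unfolding gradient_descent_map_def case_prod_conv tvec_of_scaleR[OF c dom[OF y]] by (simp only:)
  qed
  let ?S = "{y \<in> chart_img c. ?T (chart_inv c y) \<in> chart_dom c'}"
  have "Ck_on 1 {p \<in> chart_img c \<times> UNIV. ?\<Psi> p \<in> chart_dom c'} (chart_map c' \<circ> ?\<Psi>)"
    using R c c' unfolding manifold_retraction_def Ck_into_def by blast
  then have "Ck_on 1 ?S ((chart_map c' \<circ> ?\<Psi>) \<circ> (\<lambda>y. (y, (- \<eta>) *\<^sub>R u y)))"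
  proof (rule Ck_on_1_compose[rotated])
    show "Ck_on 1 ?S (\<lambda>y. (y, (- \<eta>) *\<^sub>R u y))"
      using uC1 by (rule Ck_on_1_subset) blast
    show "(\<lambda>y. (y, (- \<eta>) *\<^sub>R u y)) ` ?S \<subseteq> {p \<in> chart_img c \<times> UNIV. ?\<Psi> p \<in> chart_dom c'}"
    proof (rule image_subsetI)
      fix y assume "y \<in> ?S"
      then show "(y, (- \<eta>) *\<^sub>R u y) \<in> {p \<in> chart_img c \<times> UNIV. ?\<Psi> p \<in> chart_dom c'}"
        using T[of y] by simp
    qed
  qed
  then show "Ck_on 1 ?S (chart_map c' \<circ> ?T \<circ> chart_inv c)"
  proof (rule Ck_on_1_cong[OF _ open_chart_img[OF c]])
    show "((chart_map c' \<circ> ?\<Psi>) \<circ> (\<lambda>y. (y, (- \<eta>) *\<^sub>R u y))) y = (chart_map c' \<circ> ?T \<circ> chart_inv c) y"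
      if "y \<in> chart_img c" for y
      unfolding o_apply T[OF that] ..
  qed blast
qed

end


section \<open>Invariant local diffeomorphisms\<close>

lemma inj_funpow_eqD:
  fixes T :: "'a \<Rightarrow> 'a"
  assumes "inj T" "(T ^^ m) x = (T ^^ (m + k)) y"
  shows "x = (T ^^ k) y"
proof -
  have "(T ^^ m) x = (T ^^ m) ((T ^^ k) y)"
    using assms(2) by (simp only: funpow_add o_apply)
  then show ?thesis
    by (rule injD[OF inj_fn[OF assms(1), of m]])
qed

lemma funpow_descent:
  fixes f :: "'a \<Rightarrow> real"
  assumes "\<And>x. f (T x) \<le> f x"
  shows "f ((T ^^ n) x) \<le> f x"
  using assms by (induction n) (auto intro: order_trans)

text \<open>Choose a level \<open>r\<close> strictly between \<open>f (T x)\<close> and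
  \<open>f x\<close>. Near \<open>x\<close>, \<open>f\<close> is above \<open>r\<close> before the
  first step and below it afterwards, and descent prevents any return.\<close>

lemma descent_wandering_neighbourhood:
  fixes T :: "'a::topological_space \<Rightarrow> 'a" and f :: "'a \<Rightarrow> real"
  assumes T: "continuous_on UNIV T" "inj T" and f: "continuous_on UNIV f"
    and descent: "\<And>x. f (T x) \<le> f x" and x: "f (T x) < f x"
  shows "\<exists>V. open V \<and> x \<in> V \<and> (\<forall>y\<in>V. \<forall>z\<in>V. \<forall>m n. (T ^^ m) y = (T ^^ n) z \<longrightarrow> m = n)"
proof -
  obtain r where r: "f (T x) < r" "r < f x" using dense[OF x] by blast
  define V where "V = {y. f (T y) < r} \<inter> {y. r < f y}"
  have "open V"
    unfolding V_def
    by (intro open_Int open_Collect_less continuous_on_const f continuous_on_compose2[OF f T(1)]) auto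
  moreover have "x \<in> V" using r by (simp add: V_def)
  moreover
  \<comment> \<open>The exponent \<open>Suc k\<close> guarantees at least one step from
    \<open>z\<close>, which yields \<open>f y \<le> f (T z) < r < f y\<close>.\<close>
  have no_return: False if "y \<in> V" "z \<in> V" "(T ^^ m) y = (T ^^ (m + Suc k)) z" for y z m k
  proof -
    have "y = (T ^^ k) (T z)"
      using inj_funpow_eqD[OF T(2) that(3)] by (simp only: funpow_Suc_right o_apply)
    then have "f y \<le> f (T z)" using funpow_descent[of f T, OF descent] by simp
    then show False using that(1,2) by (simp add: V_def)
  qed
  have "m = n" if "y \<in> V" "z \<in> V" "(T ^^ m) y = (T ^^ n) z" for y z m n
  proof (cases rule: linorder_cases[of m n])
    case less
    then obtain k where "n = m + Suc k" by (auto dest: less_imp_Suc_add)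
    then show ?thesis using no_return[OF that(1,2)] that(3) by blast
  next
    case greater
    then obtain k where "m = n + Suc k" by (auto dest: less_imp_Suc_add)
    then show ?thesis using no_return[OF that(2,1)] that(3)[symmetric] by blast
  qed
  ultimately show ?thesis by (intro exI[of _ V] conjI ballI allI impI)
qed

lemma homeomorphism_funpow:
  fixes T S :: "'a::topological_space \<Rightarrow> 'a"
  assumes "homeomorphism UNIV UNIV T S"
  shows "homeomorphism UNIV UNIV (T ^^ k) (S ^^ k)"
proof (induction k)
  case 0
  show ?case by (simp add: id_def homeomorphism_ident)
next
  case (Suc k)
  show ?case
    unfolding funpow_Suc_right[of k T] funpow.simps(2)[of k S]
    by (rule homeomorphism_compose[OF assms Suc.IH])
qed

text \<open>Merging of forward orbits. For a bijection this means lying on a common two-sided orbit,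
  expressed without negative powers.\<close>

definition same_orbit :: "('a \<Rightarrow> 'a) \<Rightarrow> 'a \<Rightarrow> 'a \<Rightarrow> bool" where
  "same_orbit T x y \<longleftrightarrow> (\<exists>m n. (T ^^ m) x = (T ^^ n) y)"

lemma same_orbit_step: "same_orbit T (T x) y \<longleftrightarrow> same_orbit T x y"
proof
  assume "same_orbit T (T x) y"
  then obtain m n where "(T ^^ m) (T x) = (T ^^ n) y" unfolding same_orbit_def by blast
  then have "(T ^^ Suc m) x = (T ^^ n) y" by (simp only: funpow_Suc_right o_apply)
  then show "same_orbit T x y" unfolding same_orbit_def by blast
next
  assume "same_orbit T x y"
  then obtain m n where "(T ^^ m) x = (T ^^ n) y" unfolding same_orbit_def by blast
  then have "T ((T ^^ m) x) = T ((T ^^ n) y)" by (rule arg_cong)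
  then have "(T ^^ m) (T x) = (T ^^ Suc n) y" by (simp add: funpow_swap1)
  then show "same_orbit T (T x) y" unfolding same_orbit_def by blast
qed

text \<open>For injective \<open>T\<close> this says that each orbit meets the union of the family
  in at most one point, and that this point lies in only one member.\<close>

definition wandering_family :: "('a \<Rightarrow> 'a) \<Rightarrow> 'a set set \<Rightarrow> bool" where
  "wandering_family T \<V> \<longleftrightarrow> (\<forall>V\<in>\<V>. \<forall>V'\<in>\<V>. \<forall>x\<in>V. \<forall>y\<in>V'. \<forall>m n.
     (T ^^ m) x = (T ^^ n) y \<longrightarrow> m = n \<and> V = V')"

lemma wandering_familyD:
  assumes "wandering_family T \<V>" "V \<in> \<V>" "V' \<in> \<V>" "x \<in> V" "y \<in> V'" "(T ^^ m) x = (T ^^ n) y"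
  shows "m = n" "V = V'"
  using assms unfolding wandering_family_def by meson+

text \<open>Both relations are pushed forward to a common iterate of \<open>z\<close>. Wandering
  then forces equal exponents for \<open>x\<close> and \<open>y\<close>, and injectivity cancels
  them.\<close>

lemma wandering_family_same_orbitD:
  assumes \<V>: "wandering_family T \<V>" "inj T" "V \<in> \<V>" "V' \<in> \<V>" "x \<in> V" "y \<in> V'"
    and orb: "same_orbit T z x" "same_orbit T z y"
  shows "x = y" "V = V'"
proof -
  obtain m n where mn: "(T ^^ m) z = (T ^^ n) x" using orb(1) unfolding same_orbit_def by blast
  obtain p q where pq: "(T ^^ p) z = (T ^^ q) y" using orb(2) unfolding same_orbit_def by blast
  have "(T ^^ p) ((T ^^ n) x) = (T ^^ p) ((T ^^ m) z)" by (simp only: mn)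
  also have "\<dots> = (T ^^ m) ((T ^^ p) z)"
    unfolding o_apply[of "T ^^ _", symmetric] funpow_add[symmetric] by (simp only: add.commute)
  finally have eq: "(T ^^ (p + n)) x = (T ^^ (m + q)) y"
    by (simp only: pq funpow_add o_apply)
  show "V = V'" by (rule wandering_familyD(2)[OF \<V>(1,3-6) eq])
  have "p + n = m + q" by (rule wandering_familyD(1)[OF \<V>(1,3-6) eq])
  then have "(T ^^ (p + n)) x = (T ^^ (p + n)) y" using eq by simp
  then show "x = y" by (rule injD[OF inj_fn[OF \<V>(2)]])
qed

text \<open>Zorn's lemma. The condition involves two members at a time, and any two members of the
  union of a chain already lie in one element of the chain.\<close>

lemma maximal_wandering_family:
  "\<exists>\<V>. wandering_family T \<V> \<and> (\<forall>V\<in>\<V>. P V) \<and>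
     (\<forall>V. P V \<longrightarrow> wandering_family T (insert V \<V>) \<longrightarrow> V \<in> \<V>)"
proof -
  define \<A> where "\<A> = {\<V>. wandering_family T \<V> \<and> (\<forall>V\<in>\<V>. P V)}"
  have \<A>I: "\<V> \<in> \<A>" if "wandering_family T \<V>" "\<And>V. V \<in> \<V> \<Longrightarrow> P V" for \<V>
    using that by (simp add: \<A>_def)
  have \<A>D: "wandering_family T \<V>" "\<And>V. V \<in> \<V> \<Longrightarrow> P V" if "\<V> \<in> \<A>" for \<V>
    using that by (simp_all add: \<A>_def)
  have "\<exists>\<V>\<in>\<A>. \<forall>\<W>\<in>\<A>. \<V> \<subseteq> \<W> \<longrightarrow> \<W> = \<V>"
  proof (rule subset_Zorn')
    fix C assume "subset.chain \<A> C"
    then have C: "\<V> \<in> \<A>" "\<V> \<subseteq> \<W> \<or> \<W> \<subseteq> \<V>" if "\<V> \<in> C" "\<W> \<in> C" for \<V> \<W>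
      using that unfolding subset_chain_def by auto
    show "\<Union>C \<in> \<A>"
    proof (rule \<A>I)
      show "wandering_family T (\<Union>C)"
        unfolding wandering_family_def
      proof (intro ballI allI impI)
        fix V V' x y m n
        assume V: "V \<in> \<Union>C" "V' \<in> \<Union>C" and xy: "x \<in> V" "y \<in> V'" "(T ^^ m) x = (T ^^ n) y"
        obtain \<V> \<W> where "\<V> \<in> C" "V \<in> \<V>" "\<W> \<in> C" "V' \<in> \<W>"
          using V by (elim UnionE)
        then obtain \<U> where \<U>: "\<U> \<in> C" "V \<in> \<U>" "V' \<in> \<U>"
          using C(2)[of \<V> \<W>] by (meson subsetD)
        show "m = n \<and> V = V'"
          using wandering_familyD[OF \<A>D(1)[OF C(1)[OF \<U>(1,1)]] \<U>(2,3) xy] by (rule conjI)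
      qed
      fix V assume "V \<in> \<Union>C"
      then obtain \<V> where "\<V> \<in> C" "V \<in> \<V>" by (elim UnionE)
      then show "P V" using \<A>D(2)[OF C(1)] by blast
    qed
  qed
  then obtain \<V> where \<V>: "\<V> \<in> \<A>" "\<forall>\<W>\<in>\<A>. \<V> \<subseteq> \<W> \<longrightarrow> \<W> = \<V>" by (elim bexE)
  have "V \<in> \<V>" if "P V" "wandering_family T (insert V \<V>)" for V
  proof -
    have "insert V \<V> \<in> \<A>"
      using that \<A>D(2)[OF \<V>(1)] by (intro \<A>I) auto
    then have "insert V \<V> = \<V>" using \<V>(2) by (simp add: subset_insertI)
    then show ?thesis by (rule subst) (rule insertI1)
  qed
  then show ?thesis using \<A>D[OF \<V>(1)] by (intro exI[of _ \<V>] conjI allI ballI impI)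
qed

context atlas
begin

lemma local_diffeo_on_imp_continuous_on:
  fixes h :: "'m \<Rightarrow> real ^ 'n"
  assumes "local_diffeo_on A U h"
  shows "continuous_on U h"
proof (rule continuous_at_imp_continuous_on, rule ballI)
  fix x assume "x \<in> U"
  then obtain V k where V: "open V" "x \<in> V" "homeomorphism V (h ` V) h k"
    using local_diffeo_onE[OF assms] by metis
  show "isCont h x"
    using continuous_on_eq_continuous_at[OF V(1)] homeomorphism_cont1[OF V(3)] V(2) by blast
qed

lemma Ck_from_imp_continuous_on:
  assumes "Ck_from (Suc k) A UNIV f"
  shows "continuous_on UNIV f"
proof (rule continuous_at_imp_continuous_on, rule ballI)
  fix x
  obtain c where c: "c \<in> A" "x \<in> chart_dom c" by (rule chart_around)
  have "continuous_on (chart_dom c) (chart_map c)"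
    using chart_homeomorphism[OF c(1)] by (rule homeomorphism_cont1)
  then have "isCont (chart_map c) x"
    using continuous_on_eq_continuous_at open_chart_dom c by blast
  moreover have "isCont (f \<circ> chart_inv c) (chart_map c x)"
    using differentiable_imp_continuous_within[OF Ck_from_differentiable[OF assms c]] .
  ultimately have "isCont ((f \<circ> chart_inv c) \<circ> chart_map c) x"
    by (rule continuous_at_compose)
  moreover have "eventually (\<lambda>y. ((f \<circ> chart_inv c) \<circ> chart_map c) y = f y) (nhds x)"
    unfolding eventually_nhds
    using open_chart_dom[OF c(1)] c(2) chart_inv_map[OF c(1)]
    by (intro exI[of _ "chart_dom c"]) simp
  ultimately show "isCont f x"
    using isCont_cong by blast
qed

text \<open>The dynamical core: of gradient descent it keeps only a \<open>C1\<close> homeomorphism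
  that decreases a continuous function off its fixed points.\<close>

lemma invariant_local_diffeo:
  fixes f :: "'m \<Rightarrow> real"
  assumes T: "C1_map T" and TS: "homeomorphism UNIV UNIV T S" and f: "continuous_on UNIV f"
    and F: "F = {x. T x = x}" and descent: "\<And>x. x \<notin> F \<Longrightarrow> f (T x) < f x"
  obtains \<phi> :: "'m \<Rightarrow> real ^ 'n" and U where "\<And>x. \<phi> (T x) = \<phi> x" "open U" "U \<subseteq> - F"
    "- F \<subseteq> closure U" "local_diffeo_on A U \<phi>"
proof -
  have ST: "S (T x) = x" "T (S x) = x" for x
    using TS by (simp_all add: homeomorphism_def)
  have inj: "inj T" using ST(1) by (rule inj_on_inverseI)
  have T_cont: "continuous_on UNIV T" using TS by (rule homeomorphism_cont1)
  have le: "f (T x) \<le> f x" for x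
    using descent[of x] F by (cases "x \<in> F") auto
  have "closed F"
    unfolding F using T_cont by (intro closed_Collect_eq continuous_on_id)
  then have open_F: "open (- F)" by (rule open_Compl)

  \<comment> \<open>Each member lies in one chart domain, so a single chart map gives coordinates on
    all of it.\<close>
  define nice where "nice V \<longleftrightarrow> open V \<and> (\<exists>c\<in>A. V \<subseteq> chart_dom c)" for V
  obtain \<V> where \<V>: "wandering_family T \<V>" "\<And>V. V \<in> \<V> \<Longrightarrow> nice V"
    and max: "\<And>V. nice V \<Longrightarrow> wandering_family T (insert V \<V>) \<Longrightarrow> V \<in> \<V>"
    using maximal_wandering_family[of T nice] by blast
  obtain ch where ch: "\<And>V. V \<in> \<V> \<Longrightarrow> ch V \<in> A" "\<And>V. V \<in> \<V> \<Longrightarrow> V \<subseteq> chart_dom (ch V)"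
    using \<V>(2) unfolding nice_def by metis
  \<comment> \<open>If no member of the family meets the orbit of \<open>z\<close>, then \<open>\<pi> z\<close> is a junk value, but still the same
    for \<open>z\<close> and \<open>T z\<close>, as the predicates under \<open>SOME\<close> agree.\<close>
  define \<pi> where "\<pi> z = (SOME p. fst p \<in> \<V> \<and> snd p \<in> fst p \<and> same_orbit T z (snd p))" for z
  define \<phi> where "\<phi> z = chart_map (ch (fst (\<pi> z))) (snd (\<pi> z))" for z
  \<comment> \<open>The representative of an orbit is unique, so any known one may replace the
    choice made in \<open>\<pi>\<close>.\<close>
  have \<phi>_eq: "\<phi> z = chart_map (ch V) y" if V: "V \<in> \<V>" "y \<in> V" "same_orbit T z y" for z y V
  proof -
    have "fst (\<pi> z) \<in> \<V> \<and> snd (\<pi> z) \<in> fst (\<pi> z) \<and> same_orbit T z (snd (\<pi> z))"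
      unfolding \<pi>_def by (rule someI[of _ "(V, y)"]) (use V in simp)
    then have "snd (\<pi> z) = y" "fst (\<pi> z) = V"
      using wandering_family_same_orbitD[OF \<V>(1) inj _ V(1) _ V(2) _ V(3)] by blast+
    then show ?thesis by (simp only: \<phi>_def)
  qed
  have invariant: "\<phi> (T x) = \<phi> x" for x
    by (simp only: \<phi>_def \<pi>_def same_orbit_step)

  \<comment> \<open>Maximality: if the orbits through \<open>N\<close> avoided the whole family, a
    small wandering piece of \<open>N\<close> could be added to it.\<close>
  have meets: "\<exists>V\<in>\<V>. \<exists>y\<in>V. \<exists>z\<in>N. same_orbit T z y" if N: "open N" "N \<noteq> {}" "N \<subseteq> - F" for N
  proof (rule ccontr)
    assume "\<not> ?thesis"
    then have "\<forall>V\<in>\<V>. \<forall>y\<in>V. \<forall>z\<in>N. \<not> same_orbit T z y" by simp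
    then have none: False if "V \<in> \<V>" "y \<in> V" "z \<in> N" "same_orbit T z y" for V y z
      using that by meson
    obtain x where x: "x \<in> N" using N(2) by blast
    then have "f (T x) < f x" using N(3) descent by blast
    then have "\<exists>V. open V \<and> x \<in> V \<and> (\<forall>y\<in>V. \<forall>z\<in>V. \<forall>m n. (T ^^ m) y = (T ^^ n) z \<longrightarrow> m = n)"
      by (rule descent_wandering_neighbourhood[OF T_cont inj f le])
    then obtain V0 where V0: "open V0" "x \<in> V0"
      "\<forall>y\<in>V0. \<forall>z\<in>V0. \<forall>m n. (T ^^ m) y = (T ^^ n) z \<longrightarrow> m = n"
      by (elim exE conjE)
    obtain c where c: "c \<in> A" "x \<in> chart_dom c" by (rule chart_around)
    let ?V = "V0 \<inter> N \<inter> chart_dom c"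
    have "nice ?V"
      unfolding nice_def
      by (intro conjI bexI[OF _ c(1)] open_Int V0(1) N(1) open_chart_dom[OF c(1)]) (rule Int_lower2)
    moreover have "wandering_family T (insert ?V \<V>)"
      unfolding wandering_family_def
    proof (intro ballI allI impI)
      fix V V' y z m n
      assume V: "V \<in> insert ?V \<V>" "V' \<in> insert ?V \<V>" and y: "y \<in> V" and z: "z \<in> V'"
        and eq: "(T ^^ m) y = (T ^^ n) z"
      have orb: "same_orbit T y z" "same_orbit T z y"
        using eq unfolding same_orbit_def by metis+
      consider "V = ?V" "V' = ?V" | "V = ?V" "V' \<in> \<V>" | "V \<in> \<V>" "V' = ?V" | "V \<in> \<V>" "V' \<in> \<V>"
        using V by blast
      \<comment> \<open>Two points of the new set are handled by the choice of \<open>V0\<close>,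
        two old members by \<open>\<V>\<close>; the mixed cases contradict \<open>none\<close>, as
        \<open>?V\<close> lies in \<open>N\<close>.\<close>
      then show "m = n \<and> V = V'"
      proof cases
        case 1
        then have "y \<in> V0" "z \<in> V0" using y z by blast+
        then have "m = n" using V0(3) eq by blast
        then show ?thesis using 1 by simp
      next
        case 2
        then have "y \<in> N" using y by blast
        then show ?thesis using none[OF 2(2) z _ orb(1)] by blast
      next
        case 3
        then have "z \<in> N" using z by blast
        then show ?thesis using none[OF 3(1) y _ orb(2)] by blast
      next
        case 4
        then show ?thesis using wandering_familyD[OF \<V>(1) 4 y z eq] by (intro conjI)
      qed
    qed
    ultimately have "?V \<in> \<V>" by (rule max)
    moreover have "x \<in> ?V" using x V0(2) c(2) by simp
    moreover have "same_orbit T x x" unfolding same_orbit_def by blast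
    ultimately show False using none[OF _ _ x] by blast
  qed

  \<comment> \<open>The largest open set off \<open>F\<close> on which \<open>\<phi>\<close> is a
    local diffeomorphism, so that density can be shown by contradiction.\<close>
  define U where "U = {x. \<exists>N. open N \<and> x \<in> N \<and> N \<subseteq> - F \<and> local_diffeo_on A N \<phi>}"
  have U_sub: "N \<subseteq> U" if "open N" "N \<subseteq> - F" "local_diffeo_on A N \<phi>" for N
    unfolding U_def by (intro subsetI CollectI exI[of _ N] conjI that)
  have "open U"
    unfolding open_subopen[of U]
  proof
    fix x assume "x \<in> U"
    then obtain N where N: "open N" "x \<in> N" "N \<subseteq> - F" "local_diffeo_on A N \<phi>"
      unfolding U_def by blast
    show "\<exists>N. open N \<and> x \<in> N \<and> N \<subseteq> U"
      by (intro exI[of _ N] conjI N(1,2) U_sub N(3,4))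
  qed
  moreover have "U \<subseteq> - F" unfolding U_def by blast
  moreover have "local_diffeo_on A U \<phi>"
    unfolding local_diffeo_on_def[of A U]
  proof
    fix x assume "x \<in> U"
    then obtain N where N: "open N" "x \<in> N" "N \<subseteq> - F" "local_diffeo_on A N \<phi>"
      unfolding U_def by blast
    obtain V k where V: "open V" "x \<in> V" "V \<subseteq> N" "open (\<phi> ` V)" "homeomorphism V (\<phi> ` V) \<phi> k"
      "Ck_from 1 A V \<phi>" "Ck_into 1 A (\<phi> ` V) k"
      by (rule local_diffeo_onE[OF N(4,2)])
    show "\<exists>V k. open V \<and> x \<in> V \<and> V \<subseteq> U \<and> open (\<phi> ` V) \<and> homeomorphism V (\<phi> ` V) \<phi> k \<and>
        Ck_from 1 A V \<phi> \<and> Ck_into 1 A (\<phi> ` V) k"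
      by (intro exI[of _ V] exI[of _ k] conjI V subset_trans[OF V(3) U_sub[OF N(1,3,4)]])
  qed
  moreover have "- F \<subseteq> closure U"
  proof (rule ccontr)
    assume "\<not> ?thesis"
    then have N: "open (- F \<inter> - closure U)" "- F \<inter> - closure U \<noteq> {}" "- F \<inter> - closure U \<subseteq> - F"
      using open_F by auto
    obtain V y z where V: "V \<in> \<V>" "y \<in> V" and z: "z \<in> - F \<inter> - closure U" "same_orbit T z y"
      using meets[OF N] by (elim bexE)
    \<comment> \<open>\<open>Q\<close> is the power of \<open>T\<close> or of \<open>S\<close> that
      carries \<open>z\<close> to its representative \<open>y\<close>, depending on which of the two
      comes first along the orbit.\<close>
    have "\<exists>Q. pulls_back_local_diffeos Q \<and> continuous_on UNIV Q \<and> Q z = y \<and> (\<forall>x. same_orbit T x (Q x))"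
    proof -
      obtain m n where mn: "(T ^^ m) z = (T ^^ n) y" using z(2) unfolding same_orbit_def by blast
      show ?thesis
      proof (cases "n \<le> m")
        case True
        then obtain k where "m = n + k" using le_Suc_ex by blast
        then have "y = (T ^^ k) z" using mn inj_funpow_eqD[OF inj, of n y k z] by simp
        moreover have "pulls_back_local_diffeos (T ^^ k)"
          by (rule pulls_back_local_diffeos_funpow[OF pulls_back_local_diffeos_forward[OF T T_cont inj] TS])
        moreover have "same_orbit T x ((T ^^ k) x)" for x
          unfolding same_orbit_def by (rule exI[of _ k], rule exI[of _ 0]) simp
        moreover have "continuous_on UNIV (T ^^ k)"
          using homeomorphism_funpow[OF TS] by (rule homeomorphism_cont1)
        ultimately show ?thesis by blast
      next
        case False
        then obtain k where "n = m + k" using le_Suc_ex nat_le_linear by blast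
        then have z_eq: "z = (T ^^ k) y" using mn inj_funpow_eqD[OF inj, of m z k y] by simp
        have TSk: "(T ^^ k) ((S ^^ k) x) = x" "(S ^^ k) ((T ^^ k) x) = x" for x
          using homeomorphism_funpow[OF TS, of k] by (simp_all add: homeomorphism_def)
        have "(S ^^ k) z = y" unfolding z_eq by (rule TSk)
        moreover have "pulls_back_local_diffeos (S ^^ k)"
          by (rule pulls_back_local_diffeos_funpow[OF pulls_back_local_diffeos_backward[OF T TS]
              homeomorphism_symD[OF TS]])
        moreover have "same_orbit T x ((S ^^ k) x)" for x
          unfolding same_orbit_def by (rule exI[of _ 0], rule exI[of _ k]) (simp add: TSk)
        moreover have "continuous_on UNIV (S ^^ k)"
          using homeomorphism_funpow[OF TS] by (rule homeomorphism_cont2)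
        ultimately show ?thesis by blast
      qed
    qed
    then obtain Q where Q: "pulls_back_local_diffeos Q" "continuous_on UNIV Q" "Q z = y"
      "\<And>x. same_orbit T x (Q x)" by blast
    \<comment> \<open>For \<open>x\<close> in \<open>?N\<close>, the point \<open>Q x\<close> lies
      in \<open>V\<close> and on the orbit of \<open>x\<close>, so it is the representative of
      \<open>x\<close> and \<open>\<phi>\<close> equals
      \<open>chart_map (ch V) \<circ> Q\<close>.\<close>
    let ?N = "- F \<inter> - closure U \<inter> Q -` V"
    have "open V" using \<V>(2)[OF V(1)] by (simp only: nice_def)
    then have "open ?N" using N(1) Q(2) by (intro open_Int[OF N(1)] open_vimage)
    moreover have "?N \<noteq> {}" using z(1) V(2) Q(3) by blast
    moreover have "Q ` ?N \<subseteq> chart_dom (ch V)" using ch(2)[OF V(1)] by blast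
    ultimately obtain N' where N': "N' \<subseteq> ?N" "open N'" "N' \<noteq> {}"
      "local_diffeo_on A N' (chart_map (ch V) \<circ> Q)"
      by (rule pulls_back_local_diffeosD[OF Q(1) local_diffeo_on_chart_map[OF ch(1)[OF V(1)]]])
    have "local_diffeo_on A N' \<phi>"
    proof (rule local_diffeo_on_cong[OF N'(4)])
      show "(chart_map (ch V) \<circ> Q) x = \<phi> x" if "x \<in> N'" for x
        using \<phi>_eq[OF V(1) _ Q(4)[of x]] subsetD[OF N'(1) that] by simp
    qed
    \<comment> \<open>By the choice of \<open>U\<close> it contains \<open>N'\<close>, although
      \<open>N'\<close> is nonempty and disjoint from \<open>closure U\<close>.\<close>
    then have "N' \<subseteq> U" using U_sub[OF N'(2)] N'(1) by blast
    then show False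
      using N'(1,3) closure_subset[of U] by blast
  qed
  ultimately show ?thesis
    using that[of \<phi> U] invariant by blast
qed

end

theorem lemmaB23:
  fixes A :: "('m::{t2_space, second_countable_topology}, real ^ 'n) chart set"
    and g :: "'m \<Rightarrow> ('m, real ^ 'n) tvec \<Rightarrow> ('m, real ^ 'n) tvec \<Rightarrow> real"
    and R :: "'m \<Rightarrow> ('m, real ^ 'n) tvec \<Rightarrow> 'm"
    and f :: "'m \<Rightarrow> real"
    and \<eta> :: real
    and T :: "'m \<Rightarrow> 'm"
    and F :: "'m set"
  assumes "smooth_atlas A"
    and "riemannian_metric A g"
    and "manifold_retraction A R"
    and "Ck_from 2 A UNIV f"
    and "\<eta> > 0"
    and T_def: "T = gradient_descent_map A g R f \<eta>"
    and F_def: "F = {x. T x = x}"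
    and "\<exists>S. homeomorphism UNIV UNIV T S"
    and "\<forall>x. x \<notin> F \<longrightarrow> f (T x) < f x"
  shows "\<exists>(\<phi> :: 'n \<Rightarrow> 'm \<Rightarrow> real) U.
           (\<forall>i. invariant_under T (\<phi> i)) \<and>
           open U \<and> U \<subseteq> - F \<and> - F \<subseteq> closure U \<and>
           (\<forall>i. continuous_on U (\<phi> i)) \<and> independent_on A U \<phi>"
proof -
  interpret riemannian_atlas A g
    using assms(1,2) by unfold_locales
  obtain S where S: "homeomorphism UNIV UNIV T S" using assms(8) by blast
  have "C1_map T"
    unfolding T_def by (rule C1_map_gradient_descent_map[OF assms(3,4)])
  moreover have "continuous_on UNIV f"
    using assms(4) Ck_from_imp_continuous_on[of 1 f] by (simp add: numeral_2_eq_2)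
  moreover have "f (T x) < f x" if "x \<notin> F" for x
    using assms(9) that by blast
  ultimately obtain \<phi> :: "'m \<Rightarrow> real ^ 'n" and U where \<phi>: "\<And>x. \<phi> (T x) = \<phi> x" "open U" "U \<subseteq> - F"
    "- F \<subseteq> closure U" "local_diffeo_on A U \<phi>"
    using invariant_local_diffeo[OF _ S _ F_def] by metis
  have "continuous_on U \<phi>"
    by (rule local_diffeo_on_imp_continuous_on[OF \<phi>(5)])
  then have "continuous_on U (\<lambda>x. \<phi> x $ i)" for i
    by (intro continuous_intros)
  \<comment> \<open>The required functions are the components of \<open>\<phi>\<close>; reassembled
    into a vector they give back \<open>\<phi>\<close> itself.\<close>
  moreover have "independent_on A U (\<lambda>i x. \<phi> x $ i)"
    unfolding independent_on_def by (simp add: \<phi>(5))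
  moreover have "invariant_under T (\<lambda>x. \<phi> x $ i)" for i
    unfolding invariant_under_def by (simp add: \<phi>(1))
  ultimately show ?thesis
    using \<phi>(2-4) by (intro exI[of _ "\<lambda>i x. \<phi> x $ i"] exI[of _ U]) blast
qed

end
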